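(* Let $\mathcal{D}=[a_1,b_1]\times\cdots\times[a_d,b_d]\subseteq\mathbb{R}^d$ and let $F:\mathcal{D}\to\mathbb{R}$, $F(x)=\mathbb{E}_\omega[f(x,\omega)]$, be the objective function of the noisy problem of minimizing $F$ over $\mathcal{D}$, where only noisy evaluations $f(x,\omega)$ are observed. Suppose $F$ is continuous on $\mathcal{D}$ and $x_{\mathrm{opt}}\in\mathcal{D}$ is the unique minimizer of $F$, characterized by $F(x_{\mathrm{opt}})=\inf_{x\in\mathcal{D}}F(x)\in(-\infty,+\infty)$ and $$\inf_{x\in\mathcal{D},\ \lVert x-x_{\mathrm{opt}}\rVert\ge\eta}F(x)>F(x_{\mathrm{opt}})\quad\text{for all }\eta>0,$$ with the convention that the infimum over the empty set is $+\infty$. Run the ProSRS algorithm (described in full in the context) on this problem, with no bound on the number of iterations, and let $x_n$ be a point with the minimum value of the objective $F$ among all points evaluated by the algorithm up to iteration $n$. Then $x_n\to x_{\mathrm{opt}}$ almost surely as $n\to\infty$.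
   Context: **Problem.** $d\ge1$, $a_i<b_i$ for all $i$, $\mathcal{D}=\prod_{i=1}^d[a_i,b_i]$, and $\omega$ is the random noise in a function evaluation. Evaluating $x$ means observing $y=f(x,\omega)$. The internal random draws of the algorithm at each step (candidate points, zoom-out decisions) are fresh, i.e. independent of the past and of the noise. For a box $\Omega$, $\ell_i(\Omega)$ is its side length in dimension $i$. **Parameters.** Number $N_{\mathrm{par}}\ge1$ of points evaluated per iteration; number $m\ge 1$ of initial samples; initial zoom-out probability $\beta_{\mathrm{init}}$ and minimum zoom-out probability $\beta_{\min}$ with $0<\beta_{\min}\le\beta_{\mathrm{init}}<1$; zoom-in factor $\rho\in(0,1)$; resolution $r\in(0,1)$; initial state $S_{\mathrm{init}}=(\gamma_{\mathrm{init}},p_{\mathrm{init}},\sigma_{\mathrm{init}})$ with $\gamma_{\mathrm{init}}\le0$, $p_{\mathrm{init}}\in[0,1]$, $\sigma_{\mathrm{init}}\ge\sigma_{\mathrm{crit}}>0$; failure threshold $C_{\mathrm{fail}}\in\{1,2,\dots\}$; decrement $\Delta\gamma>0$. **Nodes.** A node is a quadruple $(D,\Omega,S,\beta)$: a box $\Omega\subseteq\mathcal{D}$, evaluation data $D$ in $\Omega$ (finitely many pairs $(x_j,y_j)$), a state $S=(\gamma,p,\sigma)$ and a zoom-out probability $\beta$. Nodes are organized in a rooted tree by zooming in (parent to child). **Design of experiments (DOE).** Generate $m$ Latin hypercube samples (maximin criterion) in $\mathcal{D}$ and evaluate them, $N_{\mathrm{par}}$ per iteration; this takes a fixed finite number of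 iterations. The current node becomes a root node with these data, $\Omega=\mathcal{D}$, $\beta=\beta_{\mathrm{init}}$, $S=S_{\mathrm{init}}$. **ProSRS.** Start with the DOE, then repeat the following iteration indefinitely, with current node $(D,\Omega,S,\beta)$, $S=(\gamma,p,\sigma)$: 1. *Surrogate.* With $D=\{(x_j,y_j)\}_{j=1}^n$, build $g(x)=\sum_{i=1}^n c_i\phi(\lVert x-x_i\rVert)$, $\phi$ a multiquadric radial basis function, where the $c_i$ minimize $$\sum_{j=1}^n e^{\gamma\hat y_j}\bigl(y_j-g(x_j)\bigr)^2+\lambda\sum_{j=1}^n c_j^2,\qquad \hat y_j=\frac{y_j-\min_k y_k}{\max_k y_k-\min_k y_k}$$ ($\hat y_j=0$ if $\max_k y_k=\min_k y_k$), and $\lambda>0$ is a regularization constant chosen from the data by cross-validation. 2. *Proposing points (SRS).* Independently generate $1000d$ candidate points in $\Omega$. A fraction $\frac1{10}\lfloor10p\rfloor$ of them are Type I: uniform on $\Omega$. The rest are Type II: $x^*$ plus a centered Gaussian vector with diagonal covariance matrix with entries $\sigma^2\ell_i(\Omega)^2$, $i=1,\dots,d$, where $x^*$ is the point in $D$ with the lowest value of $g$; a Type II point falling outside $\Omega$ is replaced by the nearest point of $\Omega$. From the candidates, select $N_{\mathrm{par}}$ points to propose, one for each weight $w$ in an array of $N_{\mathrm{par}}$ equally spaced weights in $[0.3,1]$ (if $N_{\mathrm{par}}=1$, $w$ alternates between $0.3$ and $1$ from iteration to iteration): successively for each $w$, choose a candidate minimizing $wV^R+(1-w)V^D$. Here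 $V^R\in[0,1]$ is the value of $g$ at the candidate, affinely rescaled over the candidates so that the lowest value gets score $0$ and the highest gets score $1$; $V^D\in[0,1]$ is the affinely rescaled minimum distance of the candidate from previously evaluated points and points already selected in this iteration, with largest distance getting score $0$ and smallest getting score $1$. In particular, every proposed point is one of the candidate points. 3. *Evaluation.* Evaluate the proposed points and add the results to $D$. 4. *State update.* If $p\ge0.1$, set $p\leftarrow p\,n_{\mathrm{eff}}^{-1/d}$. Here, with $n$ the number of points in $D$, partition $\Omega$ uniformly into cells with $\lceil n^{1/d}\rceil$ cells per dimension; $n_{\mathrm{eff}}$ is the number of cells containing at least one point of $D$. Otherwise, if the counter of consecutive failed iterations equals $C_{\mathrm{fail}}$, reset the counter to $0$ and set $\sigma\leftarrow\sigma/2$, $\gamma\leftarrow\gamma-\Delta\gamma$. An iteration is failed if the best (lowest) $y$ value of its proposed points does not improve on the best $y$ value of the evaluations prior to the proposing step; the counter starts at $0$ and counts consecutive failures only while $p<0.1$. 5. *Zoom in or restart.* If $\sigma<\sigma_{\mathrm{crit}}$, let $x^*$ be the point of $D$ with the lowest fit (surrogate) value. - If $x^*$ lies in the domain of no existing child of the current node, create a child: its domain is the box centered at $x^*$ with side lengths $\rho\,\ell_i(\Omega)$, intersected with $\Omega$; its data are all past evaluations in that domain; its zoom-out probability is $\beta_{\mathrm{init}}$ and its state is $S_{\mathrm{init}}$. - Otherwise, among the children whose domain contains $x^*$, select the one whose domain center is closest to $x^*$, update its data to include all past evaluations in its domain, and replace its zoom-out probability $\beta$ by $\max(\beta/2,\beta_{\min})$.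 Let $\Omega'$ be the domain of the resulting child and $n'$ the number of evaluated points in it. If $(n')^{-1/d}\ell_i(\Omega')<r(b_i-a_i)$ for all $i=1,\dots,d$ (restart condition), restart: discard the tree and all data used by the algorithm and begin again from a new DOE (the points evaluated before the restart still count as evaluated points in the definition of $x_n$). Otherwise, reset the state of the current node to $S_{\mathrm{init}}$ and make the child the current node. 6. *Zoom out.* If no restart occurred in this iteration and the current node has a parent, then with probability $\beta$ (the zoom-out probability of the current node) make its parent the current node. *)

theory Defs
  imports "HOL-Probability.Probability"
begin

type_synonym 'd pt = "real ^ 'd"
type_synonym 'd evals = "('d pt \<times> real) list"

text \<open>\<open>shape\<close> is the shape parameter of the multiquadric.\<close>

record ('d :: finite) params =
  lower :: "'d pt"
  upper :: "'d pt"
  npar :: nat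
  ninit :: nat
  beta_init :: real
  beta_min :: real
  rho :: real
  res :: real
  gamma_init :: real
  p_init :: real
  sigma_init :: real
  sigma_crit :: real
  cfail :: nat
  dgamma :: real
  shape :: real

definition valid_params :: "('d :: finite) params \<Rightarrow> bool" where
  "valid_params P \<longleftrightarrow>
     (\<forall>i. lower P $ i < upper P $ i) \<and> npar P \<ge> 1 \<and> ninit P \<ge> 1 \<and>
     0 < beta_min P \<and> beta_min P \<le> beta_init P \<and> beta_init P < 1 \<and>
     0 < rho P \<and> rho P < 1 \<and> 0 < res P \<and> res P < 1 \<and>
     gamma_init P \<le> 0 \<and> 0 \<le> p_init P \<and> p_init P \<le> 1 \<and>
     0 < sigma_crit P \<and> sigma_crit P \<le> sigma_init P \<and>
     cfail P \<ge> 1 \<and> 0 < dgamma P \<and> 0 < shape P"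

text \<open>The domain of a node is the box \<open>cbox (nlo nd) (nhi nd)\<close>; \<open>nparent\<close> is the position of
  the parent in the list of nodes that represents the tree.\<close>

record ('d :: finite) node =
  ndata :: "'d evals"
  nlo :: "'d pt"
  nhi :: "'d pt"
  ngamma :: real
  np :: real
  nsigma :: real
  nbeta :: real
  nparent :: "nat option"

definition side :: "('d :: finite) node \<Rightarrow> 'd \<Rightarrow> real" where
  "side nd i = nhi nd $ i - nlo nd $ i"

definition dom_of :: "('d :: finite) node \<Rightarrow> 'd pt set" where
  "dom_of nd = cbox (nlo nd) (nhi nd)"

definition reset_state :: "('d :: finite) params \<Rightarrow> 'd node \<Rightarrow> 'd node" where
  "reset_state P nd = nd\<lparr>ngamma := gamma_init P, np := p_init P, nsigma := sigma_init P\<rparr>"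

definition fresh_node ::
  "('d :: finite) params \<Rightarrow> 'd evals \<Rightarrow> 'd pt \<Rightarrow> 'd pt \<Rightarrow> nat option \<Rightarrow> 'd node" where
  "fresh_node P D l h par =
     \<lparr>ndata = D, nlo = l, nhi = h, ngamma = gamma_init P, np = p_init P, nsigma = sigma_init P,
      nbeta = beta_init P, nparent = par\<rparr>"

text \<open>\<open>pending\<close> holds the points of the initial design that are still to be evaluated; the design
  phase is in progress iff it is nonempty. \<open>archive\<close> contains all evaluations since the last
  restart. \<open>fails\<close> is the counter of consecutive failed iterations. \<open>flip\<close> is used only for
  \<open>npar = 1\<close>, where the weight alternates.\<close>

record ('d :: finite) astate =
  pending :: "'d pt list"
  archive :: "'d evals"
  tree :: "'d node list"
  cur :: nat
  fails :: nat
  flip :: bool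

abbreviation cur_node :: "('d :: finite) astate \<Rightarrow> 'd node" where
  "cur_node s \<equiv> tree s ! cur s"

definition latin_hypercube :: "('d :: finite) params \<Rightarrow> 'd pt list \<Rightarrow> bool" where
  "latin_hypercube P xs \<longleftrightarrow> length xs = ninit P \<and>
     (\<forall>i. \<exists>\<pi>. bij_betw \<pi> {..<ninit P} {..<ninit P} \<and>
        (\<forall>k<ninit P. xs ! k $ i \<in>
           {lower P $ i + real (\<pi> k) / real (ninit P) * (upper P $ i - lower P $ i) ..
            lower P $ i + real (\<pi> k + 1) / real (ninit P) * (upper P $ i - lower P $ i)}))"

text \<open>For a single point this is \<open>Min {}\<close>, the same value for every design, so that any design
  then satisfies the maximin criterion.\<close>

definition separation :: "('d :: finite) pt list \<Rightarrow> real" where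
  "separation xs = Min {dist (xs ! i) (xs ! j) | i j. i < j \<and> j < length xs}"

text \<open>The pool consists of the Latin hypercube samples that are compared by the maximin
  criterion.\<close>

definition maximin_design ::
  "('d :: finite) params \<Rightarrow> 'd pt list set \<Rightarrow> 'd pt list \<Rightarrow> bool" where
  "maximin_design P pool xs \<longleftrightarrow>
     finite pool \<and> (\<forall>ys\<in>pool. latin_hypercube P ys) \<and>
     xs \<in> pool \<and> (\<forall>ys\<in>pool. separation ys \<le> separation xs)"

definition doe_start :: "('d :: finite) params \<Rightarrow> 'd pt list set \<Rightarrow> 'd astate \<Rightarrow> bool" where
  "doe_start P pool s \<longleftrightarrow>
     maximin_design P pool (pending s) \<and> archive s = [] \<and> tree s = [] \<and> cur s = 0 \<and> fails s = 0"

definition evaluate ::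
  "(('d :: finite) pt \<Rightarrow> 'n \<Rightarrow> real) \<Rightarrow> (nat \<Rightarrow> 'n) \<Rightarrow> 'd pt list \<Rightarrow> 'd evals" where
  "evaluate f \<omega> xs = map (\<lambda>j. (xs ! j, f (xs ! j) (\<omega> j))) [0..<length xs]"

definition doe_step ::
  "('d :: finite) params \<Rightarrow> ('d pt \<Rightarrow> 'n \<Rightarrow> real) \<Rightarrow> (nat \<Rightarrow> 'n) \<Rightarrow> 'd pt list \<Rightarrow>
   'd astate \<Rightarrow> 'd astate \<Rightarrow> bool" where
  "doe_step P f \<omega> xs s s' \<longleftrightarrow>
     xs = take (npar P) (pending s) \<and>
     (let A = archive s @ evaluate f \<omega> xs; rest = drop (npar P) (pending s) in
      s' = s\<lparr>pending := rest, archive := A,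
             tree := (if rest = [] then [fresh_node P A (lower P) (upper P) None] else [])\<rparr>)"

definition multiquadric :: "real \<Rightarrow> real \<Rightarrow> real" where
  "multiquadric e t = sqrt (1 + (e * t)\<^sup>2)"

definition rbf :: "real \<Rightarrow> ('d :: finite) evals \<Rightarrow> (nat \<Rightarrow> real) \<Rightarrow> 'd pt \<Rightarrow> real" where
  "rbf e D c x = (\<Sum>i<length D. c i * multiquadric e (norm (x - fst (D ! i))))"

text \<open>If all values coincide, \<open>affine_score\<close> is 0, since division by 0 yields 0.\<close>

definition affine_score :: "real set \<Rightarrow> real \<Rightarrow> real" where
  "affine_score V v = (v - Min V) / (Max V - Min V)"

definition fit_loss ::
  "real \<Rightarrow> real \<Rightarrow> real \<Rightarrow> ('d :: finite) evals \<Rightarrow> (nat \<Rightarrow> real) \<Rightarrow> real" where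
  "fit_loss e \<gamma> lam D c =
     (\<Sum>j<length D. exp (\<gamma> * affine_score (snd ` set D) (snd (D ! j))) *
                     (snd (D ! j) - rbf e D c (fst (D ! j)))\<^sup>2)
     + lam * (\<Sum>j<length D. (c j)\<^sup>2)"

definition is_fit ::
  "real \<Rightarrow> real \<Rightarrow> real \<Rightarrow> ('d :: finite) evals \<Rightarrow> (nat \<Rightarrow> real) \<Rightarrow> bool" where
  "is_fit e \<gamma> lam D c \<longleftrightarrow> (\<forall>c'. fit_loss e \<gamma> lam D c \<le> fit_loss e \<gamma> lam D c')"

definition lowest_fit :: "(('d :: finite) pt \<Rightarrow> real) \<Rightarrow> 'd evals \<Rightarrow> 'd pt set" where
  "lowest_fit g D = {x \<in> fst ` set D. \<forall>x' \<in> fst ` set D. g x \<le> g x'}"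

text \<open>A candidate is an affine image of a standardized draw \<open>(u, z)\<close>, where \<open>u\<close> is uniform on the
  unit cube and \<open>z\<close> is a standard Gaussian vector: the first branch is uniform on the domain of the
  node, and the argument of \<open>closest_point\<close> is Gaussian with mean \<open>xc\<close> and independent coordinates
  of standard deviation \<open>nsigma nd * side nd i\<close>.\<close>

definition candidate ::
  "('d :: finite) node \<Rightarrow> 'd pt \<Rightarrow> (nat \<Rightarrow> 'd pt \<times> 'd pt) \<Rightarrow> nat \<Rightarrow> 'd pt" where
  "candidate nd xc q k =
     (if real k < real (1000 * CARD('d)) * (of_int \<lfloor>10 * np nd\<rfloor> / 10)
      then (\<chi> i. nlo nd $ i + fst (q k) $ i * side nd i)
      else closest_point (dom_of nd) (\<chi> i. xc $ i + nsigma nd * side nd i * snd (q k) $ i))"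

definition weight :: "('d :: finite) params \<Rightarrow> bool \<Rightarrow> nat \<Rightarrow> real" where
  "weight P b j =
     (if npar P = 1 then (if b then 1 else 3/10)
      else 3/10 + 7/10 * real j / real (npar P - 1))"

definition min_dist :: "('d :: finite) pt set \<Rightarrow> 'd pt \<Rightarrow> real" where
  "min_dist S x = Min (dist x ` S)"

definition srs_score ::
  "(('d :: finite) pt \<Rightarrow> real) \<Rightarrow> 'd pt set \<Rightarrow> 'd pt set \<Rightarrow> real \<Rightarrow> 'd pt \<Rightarrow> real" where
  "srs_score g C S w x =
     w * affine_score (g ` C) (g x) +
     (1 - w) * (1 - affine_score (min_dist S ` C) (min_dist S x))"

definition srs_select ::
  "('d :: finite) params \<Rightarrow> bool \<Rightarrow> ('d pt \<Rightarrow> real) \<Rightarrow> 'd pt set \<Rightarrow> 'd pt set \<Rightarrow> 'd pt list \<Rightarrow> bool" where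
  "srs_select P b g C S xs \<longleftrightarrow> length xs = npar P \<and>
     (\<forall>j<npar P. xs ! j \<in> C \<and>
        (\<forall>x\<in>C. srs_score g C (S \<union> set (take j xs)) (weight P b j) (xs ! j)
              \<le> srs_score g C (S \<union> set (take j xs)) (weight P b j) x))"

text \<open>The cells are half-open, except that the last cell in each dimension also contains its upper
  end point.\<close>

definition neff :: "('d :: finite) node \<Rightarrow> nat" where
  "neff nd =
     (let K = \<lceil>real (length (ndata nd)) powr (1 / real CARD('d))\<rceil> in
      card ((\<lambda>x. \<lambda>i. min (K - 1) \<lfloor>of_int K * (x $ i - nlo nd $ i) / side nd i\<rfloor>)
              ` fst ` set (ndata nd)))"

definition update_state ::
  "('d :: finite) params \<Rightarrow> bool \<Rightarrow> 'd node \<Rightarrow> nat \<Rightarrow> 'd node \<times> nat" where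
  "update_state P failed nd c =
     (if np nd \<ge> 1/10
      then (nd\<lparr>np := np nd * real (neff nd) powr (- 1 / real CARD('d))\<rparr>, c)
      else let c' = (if failed then c + 1 else 0) in
        if c' = cfail P
        then (nd\<lparr>nsigma := nsigma nd / 2, ngamma := ngamma nd - dgamma P\<rparr>, 0)
        else (nd, c'))"

definition children :: "('d :: finite) astate \<Rightarrow> nat set" where
  "children s = {j. j < length (tree s) \<and> nparent (tree s ! j) = Some (cur s)}"

definition centre :: "('d :: finite) node \<Rightarrow> 'd pt" where
  "centre nd = (1/2) *\<^sub>R (nlo nd + nhi nd)"

definition data_in :: "('d :: finite) pt set \<Rightarrow> 'd evals \<Rightarrow> 'd evals" where
  "data_in B A = filter (\<lambda>e. fst e \<in> B) A"

definition new_child :: "('d :: finite) params \<Rightarrow> 'd astate \<Rightarrow> 'd pt \<Rightarrow> 'd node" where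
  "new_child P s x =
     (let nd = cur_node s;
          l = (\<chi> i. max (nlo nd $ i) (x $ i - rho P * side nd i / 2));
          h = (\<chi> i. min (nhi nd $ i) (x $ i + rho P * side nd i / 2))
      in fresh_node P (data_in (cbox l h) (archive s)) l h (Some (cur s)))"

definition revisit :: "('d :: finite) params \<Rightarrow> 'd astate \<Rightarrow> 'd node \<Rightarrow> 'd node" where
  "revisit P s nd =
     nd\<lparr>ndata := data_in (dom_of nd) (archive s), nbeta := max (nbeta nd / 2) (beta_min P)\<rparr>"

definition restart_cond :: "('d :: finite) params \<Rightarrow> 'd node \<Rightarrow> bool" where
  "restart_cond P nd \<longleftrightarrow>
     (\<forall>i. real (length (ndata nd)) powr (- 1 / real CARD('d)) * side nd i
            < res P * (upper P $ i - lower P $ i))"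

definition zoom_in ::
  "('d :: finite) params \<Rightarrow> 'd pt list set \<Rightarrow> ('d pt \<Rightarrow> real) \<Rightarrow> 'd astate \<Rightarrow> 'd astate \<Rightarrow> bool" where
  "zoom_in P pool g s s' \<longleftrightarrow>
     (\<exists>x \<in> lowest_fit g (ndata (cur_node s)). \<exists>j child.
        (let hits = {i \<in> children s. x \<in> dom_of (tree s ! i)} in
         if hits = {} then j = length (tree s) \<and> child = new_child P s x
         else j \<in> hits \<and>
              (\<forall>i\<in>hits. dist (centre (tree s ! j)) x \<le> dist (centre (tree s ! i)) x) \<and>
              child = revisit P s (tree s ! j)) \<and>
        (if restart_cond P child then doe_start P pool s'
         else let t = (tree s)[cur s := reset_state P (cur_node s)] in
           s' = s\<lparr>tree := (if j = length t then t @ [child] else t[j := child]), cur := j\<rparr>))"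

definition zoom_out :: "real \<Rightarrow> ('d :: finite) astate \<Rightarrow> 'd astate" where
  "zoom_out v s =
     (if pending s \<noteq> [] then s
      else case nparent (cur_node s) of
             None \<Rightarrow> s
           | Some j \<Rightarrow> if v < nbeta (cur_node s) then s\<lparr>cur := j\<rparr> else s)"

text \<open>\<open>xc\<close> is the mean of the Type II candidates, \<open>xs\<close> the list of points evaluated in this
  iteration. The regularization constant and the choices among ties are left arbitrary.\<close>

definition srs_step ::
  "('d :: finite) params \<Rightarrow> ('d pt \<Rightarrow> 'n \<Rightarrow> real) \<Rightarrow> 'd pt list set \<Rightarrow> (nat \<Rightarrow> 'n) \<Rightarrow>
   (nat \<Rightarrow> 'd pt \<times> 'd pt) \<Rightarrow> 'd pt \<Rightarrow> 'd pt list \<Rightarrow> 'd astate \<Rightarrow> 'd astate \<Rightarrow> bool" where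
  "srs_step P f pool \<omega> q xc xs s s' \<longleftrightarrow>
     (\<exists>lam c. lam > 0 \<and>
        (let nd = cur_node s;
             g = rbf (shape P) (ndata nd) c;
             new = evaluate f \<omega> xs;
             failed = (\<not> Min (snd ` set new) < Min (snd ` set (archive s)));
             (nd', k) = update_state P failed (nd\<lparr>ndata := ndata nd @ new\<rparr>) (fails s);
             s1 = s\<lparr>archive := archive s @ new, tree := (tree s)[cur s := nd'],
                    fails := k, flip := \<not> flip s\<rparr>
         in is_fit (shape P) (ngamma nd) lam (ndata nd) c \<and>
            xc \<in> lowest_fit g (ndata nd) \<and>
            srs_select P (flip s) g (candidate nd xc q ` {..<1000 * CARD('d)})
              (fst ` set (archive s)) xs \<and>
            (if nsigma nd' < sigma_crit P then zoom_in P pool g s1 s' else s' = s1)))"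

definition iteration ::
  "('d :: finite) params \<Rightarrow> ('d pt \<Rightarrow> 'n \<Rightarrow> real) \<Rightarrow> 'd pt list set \<Rightarrow> (nat \<Rightarrow> 'n) \<Rightarrow>
   (nat \<Rightarrow> 'd pt \<times> 'd pt) \<Rightarrow> 'd pt \<Rightarrow> 'd pt list \<Rightarrow> 'd astate \<Rightarrow> 'd astate \<Rightarrow> bool" where
  "iteration P f pool \<omega> q xc xs s s' \<longleftrightarrow>
     (if pending s \<noteq> [] then doe_step P f \<omega> xs s s' else srs_step P f pool \<omega> q xc xs s s')"

definition list_space :: "'a measure \<Rightarrow> 'a list measure" where
  "list_space A = sigma (lists (space A))
     {{xs. length xs = n \<and> (\<forall>i<n. xs ! i \<in> B i)} | n B. \<forall>i<n. B i \<in> sets A}"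

definition evals_space :: "('d :: finite) evals measure" where
  "evals_space = list_space (borel \<Otimes>\<^sub>M borel)"

definition node_space :: "('d :: finite) node measure" where
  "node_space = vimage_algebra UNIV
     (\<lambda>nd. (ndata nd, nlo nd, nhi nd, ngamma nd, np nd, nsigma nd, nbeta nd, nparent nd))
     (evals_space \<Otimes>\<^sub>M borel \<Otimes>\<^sub>M borel \<Otimes>\<^sub>M borel \<Otimes>\<^sub>M borel \<Otimes>\<^sub>M borel \<Otimes>\<^sub>M borel \<Otimes>\<^sub>M count_space UNIV)"

definition astate_space :: "('d :: finite) astate measure" where
  "astate_space = vimage_algebra UNIV
     (\<lambda>s. (pending s, archive s, tree s, cur s, fails s, flip s))
     (list_space borel \<Otimes>\<^sub>M evals_space \<Otimes>\<^sub>M list_space node_space \<Otimes>\<^sub>M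
      count_space UNIV \<Otimes>\<^sub>M count_space UNIV \<Otimes>\<^sub>M count_space UNIV)"

definition unit_cube_law :: "(real ^ 'd :: finite) measure" where
  "unit_cube_law = uniform_measure lborel (cbox 0 1)"

definition std_gauss_law :: "(real ^ 'd :: finite) measure" where
  "std_gauss_law = density lborel (\<lambda>z. \<Prod>i\<in>UNIV. ennreal (std_normal_density (z $ i)))"

definition draw_space :: "(nat \<Rightarrow> (real ^ 'd :: finite) \<times> (real ^ 'd)) measure" where
  "draw_space = PiM {..<1000 * CARD('d)} (\<lambda>_. borel \<Otimes>\<^sub>M borel)"

definition draw_law :: "(nat \<Rightarrow> (real ^ 'd :: finite) \<times> (real ^ 'd)) measure" where
  "draw_law = PiM {..<1000 * CARD('d)} (\<lambda>_. unit_cube_law \<Otimes>\<^sub>M std_gauss_law)"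

text \<open>
  \<open>X n\<close> is the state before iteration \<open>n\<close> (counted from 0) and \<open>Y n\<close> the state in that iteration
  just before the zoom-out decision. \<open>hist n\<close> and \<open>mid n\<close> are the corresponding histories. They
  contain the noise of all evaluations, including future ones, so that independence of them means
  independence of the past and of the noise jointly. \<open>noise n j\<close> is the noise of the \<open>j\<close>-th
  evaluation of iteration \<open>n\<close>; no assumption is made on the joint law of the noise.
  \<open>pts n\<close> are the points evaluated in iteration \<open>n\<close>, \<open>pool0\<close> and \<open>pool n\<close> the designs generated
  initially and in the case of a restart in iteration \<open>n\<close>, and \<open>xc n\<close> is the mean of the Type II
  candidates of iteration \<open>n\<close>, which is known before they are drawn.
\<close>

locale prosrs_run = prob_space M + noise: prob_space N
  for M :: "'w measure" and N :: "'n measure" +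
  fixes P :: "('d :: finite) params"
    and f :: "'d pt \<Rightarrow> 'n \<Rightarrow> real"
    and hist mid :: "nat \<Rightarrow> 'w measure"
    and noise :: "nat \<Rightarrow> nat \<Rightarrow> 'w \<Rightarrow> 'n"
    and draw :: "nat \<Rightarrow> 'w \<Rightarrow> nat \<Rightarrow> 'd pt \<times> 'd pt"
    and coin :: "nat \<Rightarrow> 'w \<Rightarrow> real"
    and pool0 :: "'w \<Rightarrow> 'd pt list set"
    and pool :: "nat \<Rightarrow> 'w \<Rightarrow> 'd pt list set"
    and xc :: "nat \<Rightarrow> 'w \<Rightarrow> 'd pt"
    and pts :: "nat \<Rightarrow> 'w \<Rightarrow> 'd pt list"
    and X Y :: "nat \<Rightarrow> 'w \<Rightarrow> 'd astate"
  assumes params: "valid_params P"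
    and hist_sub: "\<And>n. subalgebra M (hist n)"
    and mid_sub: "\<And>n. subalgebra M (mid n)"
    and hist_mid: "\<And>n. subalgebra (mid n) (hist n)"
    and mid_hist: "\<And>n. subalgebra (hist (Suc n)) (mid n)"
    and noise_hist: "\<And>n k j. noise k j \<in> measurable (hist n) N"
    and noise_law: "\<And>n j. distr M N (noise n j) = N"
    and X_hist: "\<And>n. X n \<in> measurable (hist n) astate_space"
    and xc_hist: "\<And>n. xc n \<in> borel_measurable (hist n)"
    and Y_mid: "\<And>n. Y n \<in> measurable (mid n) astate_space"
    and draw_mid: "\<And>n. draw n \<in> measurable (mid n) draw_space"
    and draw_distr: "\<And>n. distr M draw_space (draw n) = draw_law"
    and draw_fresh: "\<And>n. indep_set (sets (hist n))
                           (sets (vimage_algebra (space M) (draw n) draw_space))"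
    and coin_hist: "\<And>n. coin n \<in> borel_measurable (hist (Suc n))"
    and coin_distr: "\<And>n. distr M borel (coin n) = uniform_measure lborel {0..1}"
    and coin_fresh: "\<And>n. indep_set (sets (mid n))
                           (sets (vimage_algebra (space M) (coin n) borel))"
    and start: "\<And>w. w \<in> space M \<Longrightarrow> doe_start P (pool0 w) (X 0 w)"
    and step: "\<And>n w. w \<in> space M \<Longrightarrow>
                 iteration P f (pool n w) (\<lambda>j. noise n j w) (draw n w) (xc n w) (pts n w)
                   (X n w) (Y n w)"
    and zoom: "\<And>n w. w \<in> space M \<Longrightarrow> X (Suc n) w = zoom_out (coin n w) (Y n w)"

definition evaluated :: "(nat \<Rightarrow> 'w \<Rightarrow> ('d :: finite) pt list) \<Rightarrow> nat \<Rightarrow> 'w \<Rightarrow> 'd pt set" where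
  "evaluated pts n w = (\<Union>k<n. set (pts k w))"

end

(*
  Whenever the current node is the root, all candidates of the iteration, and hence the proposed
  points, fall into a given ball around xopt with probability bounded below. It remains to see that
  the root is current infinitely often. Call the coin of an iteration good if it keeps the
  algorithm in the child when the iteration has zoomed in, and leads to the parent otherwise; the
  probability of this is at least min (beta_min, 1 - beta_init), whatever the past. A child
  entered without a restart contains at most res^(-d) evaluated points, the number of nodes between
  two restarts is bounded, and each zoom-in with a good coin adds a point to the child. Hence a
  bounded number of consecutive good coins leads to the root or to a restart, and after a restart
  the design phase, of fixed length, ends at the root. So every block of L iterations, L fixed, hits
  the ball with probability bounded below given the past, and almost surely some block does.
  Continuity of F at xopt and the separation of F from F xopt away from xopt then give convergence.
*)

theory Submission
  imports Defs
begin

subsection \<open>The zoom tree\<close>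

text \<open>Probability and pathwise reasoning are kept apart: good draws and good coins are defined
  in every iteration, whatever the current node, with conditional probability bounded below by a
  constant; the rest is a deterministic statement about runs of good iterations, proved with a
  natural-number rank. Two obstacles shape the events. The surrogate may favour any of the
  candidates, and their split into the two types varies with \<open>p\<close>; hence the target
  constrains both components of all draws at once. The targets also depend on the past, through the
  centre and deviation of the Gaussian candidates and through the question whether the node has
  changed, whereas independence speaks of fixed events; hence each target is picked from a finite
  list. Depth alone cannot serve as rank, since zooming in raises it; the rise is paid for by a
  count of points per node, truncated so that the total stays bounded.\<close>

definition cell :: "('d :: finite) params \<Rightarrow> 'd node \<Rightarrow> 'd pt \<Rightarrow> 'd \<Rightarrow> int" where
  "cell P nd x = (\<lambda>i. \<lfloor>(x $ i - nlo nd $ i) / (rho P / 2 * side nd i)\<rfloor>)"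

text \<open>A label lists cells with the latest zoom first. The mesh of \<open>cell\<close> is half
  the width of an untruncated child, so indices end at the floor of 2/\<open>rho P\<close>, which
  accounts for the upper face. Sides at depth n are at most \<open>rho P ^ n\<close> times those of
  the whole domain, and without a restart some side is at least \<open>res P\<close> times; this
  bounds the length.\<close>

definition labels :: "('d :: finite) params \<Rightarrow> ('d \<Rightarrow> int) list set" where
  "labels P = {xs. set xs \<subseteq> (UNIV \<rightarrow>\<^sub>E {0..\<lfloor>2 / rho P\<rfloor>}) \<and> res P \<le> rho P ^ length xs}"

lemma finite_labels:
  assumes "valid_params P"
  shows "finite (labels P)"
proof -
  have r: "0 < rho P" "rho P < 1" "0 < res P"
    using assms by (auto simp: valid_params_def)
  obtain n where n: "rho P ^ n < res P"
    using real_arch_pow_inv[OF r(3,2)] by blast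
  have "length xs \<le> n" if "res P \<le> rho P ^ length xs" for xs :: "('d \<Rightarrow> int) list"
  proof (rule ccontr)
    assume "\<not> length xs \<le> n"
    then have "rho P ^ length xs \<le> rho P ^ n"
      using r by (intro power_decreasing) auto
    with that n show False by simp
  qed
  then have "labels P \<subseteq> {xs. set xs \<subseteq> (UNIV \<rightarrow>\<^sub>E {0..\<lfloor>2 / rho P\<rfloor>}) \<and> length xs \<le> n}"
    by (auto simp: labels_def)
  moreover have "finite \<dots>"
    by (intro finite_lists_length_le finite_PiE) auto
  ultimately show ?thesis by (rule finite_subset)
qed

text \<open>A lower bound on \<open>nsigma\<close> is left to \<open>inv_state\<close>: between the
  state update and the reset on zooming in, the deviation of the current node may lie below
  \<open>sigma_crit P\<close>.\<close>

definition good_node :: "('d :: finite) params \<Rightarrow> 'd node \<Rightarrow> bool" where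
  "good_node P nd \<longleftrightarrow>
     (\<forall>i. lower P $ i \<le> nlo nd $ i \<and> nlo nd $ i \<le> nhi nd $ i \<and> nhi nd $ i \<le> upper P $ i) \<and>
     fst ` set (ndata nd) \<subseteq> dom_of nd \<and>
     nsigma nd \<le> sigma_init P \<and> beta_min P \<le> nbeta nd \<and> nbeta nd \<le> beta_init P"

text \<open>The label of a node is the path of grid cells that leads to it. A cell of the parent that
  occurs in a label is covered by the child, so no second child is created in that cell: labels are
  distinct, and there are only finitely many of them.\<close>

definition good_tree ::
  "('d :: finite) params \<Rightarrow> 'd node list \<Rightarrow> (nat \<Rightarrow> ('d \<Rightarrow> int) list) \<Rightarrow> bool" where
  "good_tree P t lab \<longleftrightarrow> inj_on lab {..<length t} \<and>
     (\<forall>i<length t. good_node P (t ! i) \<and> lab i \<in> labels P \<and>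
        (\<forall>k. side (t ! i) k \<le> rho P ^ length (lab i) * (upper P $ k - lower P $ k)) \<and>
        (case nparent (t ! i) of
           None \<Rightarrow> i = 0 \<and> lab i = [] \<and> nlo (t ! i) = lower P \<and> nhi (t ! i) = upper P
         | Some j \<Rightarrow> j < i \<and> (\<exists>c. lab i = c # lab j \<and>
             (\<forall>x\<in>dom_of (t ! j). cell P (t ! j) x = c \<longrightarrow> x \<in> dom_of (t ! i)))))"

lemma good_treeD:
  assumes "good_tree P t lab" "i < length t"
  shows "good_node P (t ! i)" "lab i \<in> labels P"
    "\<And>k. side (t ! i) k \<le> rho P ^ length (lab i) * (upper P $ k - lower P $ k)"
    "nparent (t ! i) = None \<Longrightarrow> i = 0 \<and> lab i = [] \<and> nlo (t ! i) = lower P \<and> nhi (t ! i) = upper P"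
    "\<And>j. nparent (t ! i) = Some j \<Longrightarrow> j < i \<and> (\<exists>c. lab i = c # lab j \<and>
             (\<forall>x\<in>dom_of (t ! j). cell P (t ! j) x = c \<longrightarrow> x \<in> dom_of (t ! i)))"
  using assms unfolding good_tree_def by (auto split: option.splits)

lemma good_tree_update:
  assumes t: "good_tree P t lab" and nd: "good_node P nd"
    and geo: "nlo nd = nlo (t ! k)" "nhi nd = nhi (t ! k)" "nparent nd = nparent (t ! k)"
  shows "good_tree P (t[k := nd]) lab"
proof (cases "k < length t")
  case True
  have g: "nlo (t[k := nd] ! i) = nlo (t ! i)" "nhi (t[k := nd] ! i) = nhi (t ! i)"
    "nparent (t[k := nd] ! i) = nparent (t ! i)" for i
    using geo True by (cases "i = k"; simp)+
  have g': "side (t[k := nd] ! i) = side (t ! i)" "dom_of (t[k := nd] ! i) = dom_of (t ! i)"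
     "cell P (t[k := nd] ! i) = cell P (t ! i)" for i
    using g by (auto simp: side_def dom_of_def cell_def fun_eq_iff)
  have "good_node P (t[k := nd] ! i)" if "i < length t" for i
    using t nd that by (cases "i = k") (auto simp: good_tree_def)
  then show ?thesis
    using t unfolding good_tree_def g g' length_list_update by blast
qed (use t in \<open>simp add: not_less list_update_beyond\<close>)

lemma cell_in_range:
  assumes P: "valid_params P" and x: "x \<in> dom_of nd"
  shows "cell P nd x \<in> UNIV \<rightarrow>\<^sub>E {0..\<lfloor>2 / rho P\<rfloor>}"
proof -
  have r: "0 < rho P" using P by (auto simp: valid_params_def)
  have "0 \<le> (x $ i - nlo nd $ i) / (rho P / 2 * side nd i)"
    "(x $ i - nlo nd $ i) / (rho P / 2 * side nd i) \<le> 2 / rho P" for i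
  proof -
    have b: "nlo nd $ i \<le> x $ i" "x $ i \<le> nhi nd $ i"
      using x by (auto simp: dom_of_def mem_box_cart)
    then show "0 \<le> (x $ i - nlo nd $ i) / (rho P / 2 * side nd i)"
      using r by (auto simp: side_def intro!: divide_nonneg_nonneg mult_nonneg_nonneg)
    show "(x $ i - nlo nd $ i) / (rho P / 2 * side nd i) \<le> 2 / rho P"
    proof (cases "side nd i = 0")
      case False
      then have "side nd i > 0" using b by (auto simp: side_def)
      then show ?thesis using b r by (simp add: field_simps side_def)
    qed (use r in auto)
  qed
  then show ?thesis
    by (auto simp: cell_def PiE_def Pi_def intro: floor_mono)
qed

text \<open>Quotients with equal floors differ by at most 1, that is, the points differ by at most
  one mesh width. This is the half-width of a child's box, so a child centred in a cell covers all
  of the cell that lies in the parent. In a dimension of side 0 the points agree anyway.\<close>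

lemma same_cell_close:
  assumes P: "valid_params P" and x: "x \<in> dom_of nd" "y \<in> dom_of nd" "cell P nd x = cell P nd y"
  shows "\<bar>x $ i - y $ i\<bar> \<le> rho P * side nd i / 2"
proof (cases "side nd i = 0")
  case True
  have "nlo nd $ i \<le> x $ i" "x $ i \<le> nhi nd $ i" "nlo nd $ i \<le> y $ i" "y $ i \<le> nhi nd $ i"
    using x by (auto simp: dom_of_def mem_box_cart)
  with True show ?thesis by (simp add: side_def)
next
  case False
  have r: "0 < rho P" using P by (auto simp: valid_params_def)
  have "nlo nd $ i \<le> x $ i" "x $ i \<le> nhi nd $ i"
    using x by (auto simp: dom_of_def mem_box_cart)
  with False have s: "rho P / 2 * side nd i > 0" (is "?c > 0") using r by (auto simp: side_def)
  have "\<lfloor>(x $ i - nlo nd $ i) / ?c\<rfloor> = \<lfloor>(y $ i - nlo nd $ i) / ?c\<rfloor>"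
    using x(3) by (auto simp: cell_def dest: fun_cong)
  then have "\<bar>(x $ i - nlo nd $ i) / ?c - (y $ i - nlo nd $ i) / ?c\<bar> \<le> 1"
    by linarith
  also have "(x $ i - nlo nd $ i) / ?c - (y $ i - nlo nd $ i) / ?c = (x $ i - y $ i) / ?c"
    by (simp add: diff_divide_distrib)
  finally have "\<bar>x $ i - y $ i\<bar> \<le> ?c" using s by (simp add: abs_divide del: times_divide_eq_left)
  then show ?thesis by simp
qed

definition zoom_box :: "('d :: finite) params \<Rightarrow> 'd node \<Rightarrow> 'd pt \<Rightarrow> 'd pt \<times> 'd pt" where
  "zoom_box P nd x =
     ((\<chi> i. max (nlo nd $ i) (x $ i - rho P * side nd i / 2)),
      (\<chi> i. min (nhi nd $ i) (x $ i + rho P * side nd i / 2)))"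

lemma powr_neg_inverse_le_1: "real n powr (- 1 / real d) \<le> 1"
proof (cases "n = 0")
  case False
  then have "real n powr (- 1 / real d) \<le> real n powr 0"
    by (intro powr_mono) auto
  with False show ?thesis by simp
qed simp

text \<open>If a node has sides no longer than those of the whole domain and more than
  \<open>res P\<close> to the power -d points, then n to the power -1/d is below
  \<open>res P\<close> and the restart condition holds.\<close>

definition crowd :: "('d :: finite) params \<Rightarrow> nat" where
  "crowd P = nat \<lceil>res P powr - real CARD('d)\<rceil>"

text \<open>The conclusions bound depth and number of points. A dimension in which the restart
  condition fails gives \<open>res P \<le> q * b\<close> with q the power -1/d of the number of
  points; estimating q by 1 yields the first bound, estimating \<open>b\<close> by 1 the
  second.\<close>

lemma not_restart_cond:
  fixes P :: "('d :: finite) params"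
  assumes P: "valid_params P" and nr: "\<not> restart_cond P nd"
    and s: "\<And>k. side nd k \<le> b * (upper P $ k - lower P $ k)" and b: "0 \<le> b" "b \<le> 1"
  shows "res P \<le> b" "length (ndata nd) \<le> crowd P"
proof -
  let ?n = "real (length (ndata nd))"
  let ?q = "?n powr (- 1 / real CARD('d))"
  obtain i where i: "res P * (upper P $ i - lower P $ i) \<le> ?q * side nd i"
    using nr by (auto simp: restart_cond_def not_less)
  have u: "0 < upper P $ i - lower P $ i" "0 < res P" using P by (auto simp: valid_params_def)
  have "?q * side nd i \<le> ?q * (b * (upper P $ i - lower P $ i))"
    by (intro mult_left_mono s) auto
  with i have "res P * (upper P $ i - lower P $ i) \<le> (?q * b) * (upper P $ i - lower P $ i)"
    by (simp add: mult.assoc)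
  with u have q: "res P \<le> ?q * b" by simp
  have "?q * b \<le> 1 * b" by (intro mult_right_mono powr_neg_inverse_le_1 b)
  with q show "res P \<le> b" by simp
  have "?q * b \<le> ?q * 1" by (intro mult_left_mono b) auto
  with q have q': "res P \<le> ?q" by simp
  \<comment> \<open>For an empty node \<open>?q\<close> would be 0, because \<open>0 powr\<close>
    anything is 0.\<close>
  with u have n0: "?n > 0" by (cases "?n = 0") auto
  have "?q powr - real CARD('d) \<le> res P powr - real CARD('d)"
    using q' u by (intro powr_mono2') auto
  moreover have "?q powr - real CARD('d) = ?n"
    using n0 by (simp add: powr_powr)
  ultimately have "?n \<le> res P powr - real CARD('d)" by simp
  then show "length (ndata nd) \<le> crowd P"
    unfolding crowd_def by linarith
qed

text \<open>A clash of labels would force equal parents by injectivity, and then an existing child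
  covering the cell of \<open>x\<close>, which \<open>new\<close> excludes. The failed restart
  condition keeps the longer label in \<open>labels P\<close>.\<close>

lemma good_tree_snoc:
  assumes P: "valid_params P" and t: "good_tree P t lab" and j: "j < length t"
    and x: "x \<in> dom_of (t ! j)"
    and new: "\<And>i. i < length t \<Longrightarrow> nparent (t ! i) = Some j \<Longrightarrow> x \<notin> dom_of (t ! i)"
    and nd: "(nlo nd, nhi nd) = zoom_box P (t ! j) x" "nparent nd = Some j"
      "fst ` set (ndata nd) \<subseteq> dom_of nd" "nsigma nd = sigma_init P" "nbeta nd = beta_init P"
    and nr: "\<not> restart_cond P nd"
  shows "good_tree P (t @ [nd]) (lab(length t := cell P (t ! j) x # lab j))" (is "good_tree P _ ?lab")
    and "length (ndata nd) \<le> crowd P"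
proof -
  let ?n = "length t" and ?p = "t ! j"
  note gj = good_treeD[OF t j]
  have r: "0 < rho P" "rho P < 1" "0 < res P" using P by (auto simp: valid_params_def)
  have xb: "nlo ?p $ k \<le> x $ k" "x $ k \<le> nhi ?p $ k" for k
    using x by (auto simp: dom_of_def mem_box_cart)
  have pb: "lower P $ k \<le> nlo ?p $ k" "nlo ?p $ k \<le> nhi ?p $ k" "nhi ?p $ k \<le> upper P $ k" for k
    using gj(1) by (auto simp: good_node_def)
  have l: "nlo nd $ k = max (nlo ?p $ k) (x $ k - rho P * side ?p k / 2)"
    and h: "nhi nd $ k = min (nhi ?p $ k) (x $ k + rho P * side ?p k / 2)" for k
    using nd(1) by (auto simp: zoom_box_def)
  have sp: "0 \<le> rho P * side ?p k" for k
    using r pb by (auto simp: side_def)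
  have box: "lower P $ k \<le> nlo nd $ k" "nlo nd $ k \<le> x $ k" "x $ k \<le> nhi nd $ k"
      "nhi nd $ k \<le> upper P $ k" for k
    using xb[of k] pb[of k] sp[of k] unfolding l h by (auto simp: max_def min_def)
  have "side nd k \<le> rho P * side ?p k" for k
    unfolding side_def[of nd] l h by (auto simp: max_def min_def)
  also have "rho P * side ?p k \<le> rho P * (rho P ^ length (lab j) * (upper P $ k - lower P $ k))" for k
    using gj(3) r by (intro mult_left_mono) auto
  finally have side: "side nd k \<le> rho P ^ Suc (length (lab j)) * (upper P $ k - lower P $ k)" for k
    by (simp add: mult.assoc)
  have pw: "0 \<le> rho P ^ Suc (length (lab j))" "rho P ^ Suc (length (lab j)) \<le> 1"
    using r by (auto intro!: power_le_one simp del: power_Suc)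
  note nrc = not_restart_cond[OF P nr side pw]
  show "length (ndata nd) \<le> crowd P" by (rule nrc)
  have gn: "good_node P nd"
    unfolding good_node_def using box order_trans[OF box(2,3)] nd P by (auto simp: valid_params_def)
  have lab: "cell P ?p x # lab j \<in> labels P"
    using gj(2) nrc(1) cell_in_range[OF P x] by (auto simp: labels_def)
  have cov: "y \<in> dom_of nd" if "y \<in> dom_of ?p" "cell P ?p y = cell P ?p x" for y
  proof -
    have "\<bar>y $ k - x $ k\<bar> \<le> rho P * side ?p k / 2" for k
      by (rule same_cell_close[OF P that(1) x that(2)])
    moreover have "nlo ?p $ k \<le> y $ k" "y $ k \<le> nhi ?p $ k" for k
      using that(1) by (auto simp: dom_of_def mem_box_cart)
    ultimately have "nlo nd $ k \<le> y $ k" "y $ k \<le> nhi nd $ k" for k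
      unfolding l h abs_le_iff by (smt (verit))+
    then show ?thesis
      unfolding dom_of_def mem_box_cart by blast
  qed
  have fresh: "lab i \<noteq> cell P ?p x # lab j" if i: "i < ?n" for i
  proof
    assume eq: "lab i = cell P ?p x # lab j"
    show False
    proof (cases "nparent (t ! i)")
      case None
      with good_treeD(4)[OF t i] eq show False by simp
    next
      case (Some j')
      from good_treeD(5)[OF t i Some] eq have j': "j' < i" "lab j' = lab j"
        and c: "\<forall>y\<in>dom_of (t ! j'). cell P (t ! j') y = cell P ?p x \<longrightarrow> y \<in> dom_of (t ! i)"
        by auto
      have "j' = j"
        using t j j' i unfolding good_tree_def by (auto dest: inj_onD)
      with c x new[OF i] Some show False by auto
    qed
  qed
  have inj: "inj_on ?lab {..<Suc ?n}"
    using t fresh unfolding good_tree_def lessThan_Suc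
    by (auto simp: inj_on_def) metis+
  have nth: "(t @ [nd]) ! i = (if i < ?n then t ! i else nd)" if "i < Suc ?n" for i
    using that by (auto simp: nth_append)
  have node: "good_node P ((t @ [nd]) ! i) \<and> ?lab i \<in> labels P \<and>
        (\<forall>k. side ((t @ [nd]) ! i) k \<le> rho P ^ length (?lab i) * (upper P $ k - lower P $ k)) \<and>
        (case nparent ((t @ [nd]) ! i) of
           None \<Rightarrow> i = 0 \<and> ?lab i = [] \<and> nlo ((t @ [nd]) ! i) = lower P \<and> nhi ((t @ [nd]) ! i) = upper P
         | Some j \<Rightarrow> j < i \<and> (\<exists>c. ?lab i = c # ?lab j \<and>
             (\<forall>x\<in>dom_of ((t @ [nd]) ! j). cell P ((t @ [nd]) ! j) x = c \<longrightarrow> x \<in> dom_of ((t @ [nd]) ! i))))"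
    if i: "i < Suc ?n" for i
  proof (cases "i < ?n")
    case True
    then show ?thesis
      using good_treeD[OF t True] by (auto simp: nth_append split: option.splits)
  next
    case False
    with i have [simp]: "i = ?n" by simp
    show ?thesis
      using gn lab side cov j nd(2) by (auto simp: nth_append)
  qed
  show "good_tree P (t @ [nd]) ?lab"
    unfolding good_tree_def using inj node by simp
qed

subsection \<open>Progress towards the root\<close>

text \<open>Points are counted in the archive: \<open>ndata\<close> of a node that is not current
  misses later evaluations, whereas the archive only grows until the next restart.\<close>

definition count_in :: "('d :: finite) node list \<Rightarrow> 'd evals \<Rightarrow> nat \<Rightarrow> nat" where
  "count_in t A i = length (data_in (dom_of (t ! i)) A)"

text \<open>Truncation at \<open>crowd P + 1\<close> keeps the sum bounded and still registers every
  point added to a node with at most \<open>crowd P\<close> points.\<close>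

definition occupancy :: "('d :: finite) params \<Rightarrow> 'd node list \<Rightarrow> 'd evals \<Rightarrow> nat" where
  "occupancy P t A = (\<Sum>i<length t. min (count_in t A i) (crowd P + 1))"

text \<open>The last summand pays in advance for the point that the next iteration adds to an
  uncrowded current node. Thus a zoom-in is rewarded at once, and leaving the child after that
  iteration loses nothing.\<close>

definition progress :: "('d :: finite) params \<Rightarrow> 'd astate \<Rightarrow> nat" where
  "progress P s = occupancy P (tree s) (archive s) +
     (if count_in (tree s) (archive s) (cur s) \<le> crowd P then 1 else 0)"

definition progress_max :: "('d :: finite) params \<Rightarrow> nat" where
  "progress_max P = card (labels P) * (crowd P + 1) + 1"

definition inv_state ::
  "('d :: finite) params \<Rightarrow> 'd astate \<Rightarrow> (nat \<Rightarrow> ('d \<Rightarrow> int) list) \<Rightarrow> bool" where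
  "inv_state P s lab \<longleftrightarrow> fst ` set (archive s) \<subseteq> cbox (lower P) (upper P) \<and>
     (if pending s \<noteq> []
      then cur s = 0 \<and> length (pending s) \<le> ninit P \<and> set (pending s) \<subseteq> cbox (lower P) (upper P)
      else cur s < length (tree s) \<and> good_tree P (tree s) lab \<and>
           (\<forall>i<length (tree s). sigma_crit P \<le> nsigma (tree s ! i)))"

text \<open>An iteration that neither zooms in nor restarts and then zooms out lowers the depth. One that
  zooms in and then stays increases \<^const>\<open>progress\<close>: a child that does not trigger a restart
  contains at most \<^const>\<open>crowd\<close> points, and the next iteration adds a point to it.\<close>

definition state_rank ::
  "('d :: finite) params \<Rightarrow> 'd astate \<Rightarrow> (nat \<Rightarrow> ('d \<Rightarrow> int) list) \<Rightarrow> nat" where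
  "state_rank P s lab =
     (if pending s \<noteq> [] then length (pending s) else if cur s = 0 then 0
      else ninit P + 1 + 2 * (progress_max P - progress P s) + length (lab (cur s)))"

definition state_rank_max :: "('d :: finite) params \<Rightarrow> nat" where
  "state_rank_max P = ninit P + 1 + 2 * progress_max P + Max (length ` labels P)"

lemma occupancy_le:
  assumes "valid_params P" "good_tree P t lab"
  shows "occupancy P t A \<le> card (labels P) * (crowd P + 1)"
proof -
  have "card {..<length t} \<le> card (labels P)"
    using assms finite_labels by (intro card_inj_on_le[of lab]) (auto simp: good_tree_def)
  have "occupancy P t A \<le> of_nat (card {..<length t}) * (crowd P + 1)"
    unfolding occupancy_def by (rule sum_bounded_above) auto
  also have "\<dots> \<le> of_nat (card (labels P)) * (crowd P + 1)"
    using \<open>card {..<length t} \<le> card (labels P)\<close> by (intro mult_right_mono) auto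
  finally show ?thesis by simp
qed

lemma progress_le:
  assumes "valid_params P" "inv_state P s lab" "pending s = []"
  shows "progress P s \<le> progress_max P"
  using occupancy_le[OF assms(1), of "tree s" lab "archive s"] assms(2,3)
  by (auto simp: progress_def progress_max_def inv_state_def)

lemma state_rank_le:
  assumes P: "valid_params P" and s: "inv_state P s lab"
  shows "state_rank P s lab \<le> state_rank_max P"
proof (cases "pending s = []")
  case True
  then have "lab (cur s) \<in> labels P"
    using s good_treeD(2) by (auto simp: inv_state_def)
  then have "length (lab (cur s)) \<le> Max (length ` labels P)"
    using finite_labels[OF P] by (intro Max_ge) auto
  with True show ?thesis by (auto simp: state_rank_def state_rank_max_def)
next
  case False
  then show ?thesis using s by (auto simp: state_rank_def state_rank_max_def inv_state_def)
qed

lemma count_in_append_ge: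
  assumes "dom_of (t' ! i) = dom_of (t ! i)"
  shows "count_in t A i \<le> count_in t' (A @ B) i"
  using assms by (simp add: count_in_def data_in_def)

text \<open>The new points all fall into node \<open>k\<close>, where truncation hides them only if
  the node is already crowded. Other counts do not fall, and additional nodes of \<open>t'\<close>
  contribute nonnegative terms.\<close>

lemma occupancy_append:
  assumes geo: "\<And>i. i < length t \<Longrightarrow> i < length t' \<and> dom_of (t' ! i) = dom_of (t ! i)"
    and k: "k < length t" and B: "B \<noteq> []" "fst ` set B \<subseteq> dom_of (t ! k)"
  shows "occupancy P t A + (if count_in t A k \<le> crowd P then 1 else 0)
         \<le> occupancy P t' (A @ B)"
proof -
  let ?m = "\<lambda>t A i. min (count_in t A i) (crowd P + 1)"
  have filt: "filter (\<lambda>e. fst e \<in> dom_of (t ! k)) B = B"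
    using B(2) by (auto simp: filter_id_conv)
  have "count_in t' (A @ B) k = count_in t A k + length B"
    using geo[OF k] filt by (simp add: count_in_def data_in_def)
  moreover have "length B \<ge> 1" using B(1) by (cases B) auto
  ultimately have at_k: "?m t A k + (if count_in t A k \<le> crowd P then 1 else 0) \<le> ?m t' (A @ B) k"
    by auto
  have rest: "sum (?m t A) ({..<length t} - {k}) \<le> sum (?m t' (A @ B)) ({..<length t} - {k})"
  proof (rule sum_mono)
    fix i assume "i \<in> {..<length t} - {k}"
    then have "dom_of (t' ! i) = dom_of (t ! i)" using geo by auto
    from count_in_append_ge[OF this] show "?m t A i \<le> ?m t' (A @ B) i"
      by (meson min.mono order_refl)
  qed
  have "sum (?m t A) {..<length t} + (if count_in t A k \<le> crowd P then 1 else 0)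
        \<le> sum (?m t' (A @ B)) {..<length t}"
    using sum.remove[of "{..<length t}" k "?m t A"] sum.remove[of "{..<length t}" k "?m t' (A @ B)"]
      k at_k rest by auto
  also have "\<dots> \<le> sum (?m t' (A @ B)) {..<length t'}"
    by (intro sum_mono2 subsetI) (auto dest: geo)
  finally show ?thesis by (simp add: occupancy_def)
qed

section \<open>Effect of a single iteration on the invariant and the rank\<close>

lemma candidate_in_dom:
  assumes nd: "good_node P nd" and u: "fst (q k) \<in> cbox 0 1"
  shows "candidate nd xc q k \<in> dom_of nd"
proof -
  have b: "nlo nd $ i \<le> nhi nd $ i" for i using nd by (auto simp: good_node_def)
  have u': "0 \<le> fst (q k) $ i" "fst (q k) $ i \<le> 1" for i
    using u by (auto simp: mem_box_cart)
  have "nlo nd $ i + fst (q k) $ i * side nd i \<le> nhi nd $ i" for i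
    using mult_right_mono[OF u'(2), of "side nd i" i] b[of i] by (simp add: side_def)
  moreover have "0 \<le> fst (q k) $ i * side nd i" for i
    using u' b by (simp add: side_def)
  moreover have "dom_of nd \<noteq> {}"
    using b by (auto simp: dom_of_def interval_ne_empty_cart)
  moreover have "closed (dom_of nd)" by (simp add: dom_of_def closed_cbox)
  ultimately show ?thesis
    unfolding candidate_def by (auto simp: closest_point_in_set) (simp add: dom_of_def mem_box_cart)
qed

lemma evaluate_simps:
  "fst ` set (evaluate f \<omega> xs) = set xs" "evaluate f \<omega> xs = [] \<longleftrightarrow> xs = []"
  by (force simp: evaluate_def in_set_conv_nth image_iff) (simp add: evaluate_def)

text \<open>The hypothesis on \<open>nsigma\<close> omits the current node, whose deviation has just
  dropped below the critical value and is restored by the reset. A new child and a revisited one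
  both get their data recomputed from the archive, so the failed restart condition bounds the count
  in the archive.\<close>

lemma zoom_in_cases:
  assumes P: "valid_params P"
    and t: "good_tree P (tree s) lab" and cur: "cur s < length (tree s)"
    and sg: "\<And>i. i < length (tree s) \<Longrightarrow> i \<noteq> cur s \<Longrightarrow> sigma_crit P \<le> nsigma (tree s ! i)"
    and z: "zoom_in P pool g s y"
  shows "doe_start P pool y \<or>
    (\<exists>lab'. pending y = pending s \<and> archive y = archive s \<and>
       cur y < length (tree y) \<and> good_tree P (tree y) lab' \<and>
       (\<forall>i<length (tree y). sigma_crit P \<le> nsigma (tree y ! i)) \<and>
       (\<forall>i<length (tree s). i < length (tree y) \<and> dom_of (tree y ! i) = dom_of (tree s ! i)) \<and>
       cur y \<noteq> cur s \<and> length (lab' (cur y)) = Suc (length (lab (cur s))) \<and>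
       count_in (tree y) (archive y) (cur y) \<le> crowd P)"
proof -
  let ?t = "(tree s)[cur s := reset_state P (cur_node s)]"
  define hits where "hits x = {i \<in> children s. x \<in> dom_of (tree s ! i)}" for x
  from z obtain x j child where x: "x \<in> lowest_fit g (ndata (cur_node s))"
    and c: "if hits x = {} then j = length (tree s) \<and> child = new_child P s x
         else j \<in> hits x \<and>
              (\<forall>i\<in>hits x. dist (centre (tree s ! j)) x \<le> dist (centre (tree s ! i)) x) \<and>
              child = revisit P s (tree s ! j)"
    and y: "if restart_cond P child then doe_start P pool y
         else y = s\<lparr>tree := (if j = length ?t then ?t @ [child] else ?t[j := child]), cur := j\<rparr>"
    unfolding zoom_in_def Let_def hits_def[symmetric] by blast
  note gc = good_treeD[OF t cur]
  have v: "sigma_crit P \<le> sigma_init P" "beta_min P \<le> beta_init P" "0 < rho P" "rho P < 1"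
    "0 < beta_min P"
    using P by (auto simp: valid_params_def)
  have xd: "x \<in> dom_of (cur_node s)"
    using x gc(1) by (auto simp: lowest_fit_def good_node_def)
  have t': "good_tree P ?t lab"
    using gc(1) by (intro good_tree_update[OF t]) (auto simp: reset_state_def good_node_def dom_of_def)
  have len: "length ?t = length (tree s)" by simp
  have dm: "dom_of (?t ! i) = dom_of (tree s ! i)" "nparent (?t ! i) = nparent (tree s ! i)" for i
    using cur by (cases "i = cur s"; simp add: reset_state_def dom_of_def)+
  have zb: "zoom_box P (?t ! cur s) x = zoom_box P (cur_node s) x"
    using cur by (simp add: reset_state_def zoom_box_def side_def)
  have sg': "sigma_crit P \<le> nsigma (?t ! i)" if "i < length (tree s)" for i
    using that sg[of i] v cur by (cases "i = cur s") (auto simp: reset_state_def)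
  show ?thesis
  proof (cases "restart_cond P child")
    case True
    with y show ?thesis by simp
  next
    case nr: False
    show ?thesis
    proof (cases "hits x = {}")
      case True
      with c have j: "j = length (tree s)" and child: "child = new_child P s x" by auto
      have ch: "(nlo child, nhi child) = zoom_box P (?t ! cur s) x" "nparent child = Some (cur s)"
        "fst ` set (ndata child) \<subseteq> dom_of child" "nsigma child = sigma_init P"
        "nbeta child = beta_init P" "ndata child = data_in (dom_of child) (archive s)"
        unfolding zb by (auto simp: child new_child_def Let_def fresh_node_def zoom_box_def dom_of_def
            data_in_def)
      have new: "x \<notin> dom_of (?t ! i)" if "i < length ?t" "nparent (?t ! i) = Some (cur s)" for i
        using that True by (auto simp: hits_def children_def dm)
      let ?lab = "lab(length ?t := cell P (?t ! cur s) x # lab (cur s))"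
      have cur': "cur s < length ?t" using cur by simp
      have xd': "x \<in> dom_of (?t ! cur s)" using xd by (simp add: dm)
      note sn = good_tree_snoc[OF P t' cur' xd' new ch(1-5) nr]
      have ys: "tree y = ?t @ [child]" "cur y = length ?t" "pending y = pending s"
        "archive y = archive s"
        using y nr j by auto
      have "count_in (tree y) (archive y) (cur y) \<le> crowd P"
        using sn(2) ch(6) unfolding ys count_in_def nth_append_length by simp
      moreover have "\<forall>i<length (tree y). sigma_crit P \<le> nsigma (tree y ! i)"
        unfolding ys using sg' v ch(4) by (auto simp: nth_append)
      moreover have "\<forall>i<length (tree s). i < length (tree y) \<and> dom_of (tree y ! i) = dom_of (tree s ! i)"
        unfolding ys using dm by (auto simp: nth_append)
      ultimately show ?thesis
        using sn(1) ys cur by (intro disjI2 exI[of _ ?lab]) auto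
    next
      case False
      with c have j: "j \<in> hits x" and child: "child = revisit P s (tree s ! j)" by auto
      from j have jl: "j < length (tree s)" and jp: "nparent (tree s ! j) = Some (cur s)"
        by (auto simp: hits_def children_def)
      note gj = good_treeD[OF t jl]
      have jn: "j \<noteq> cur s" and lj: "length (lab j) = Suc (length (lab (cur s)))"
        using gj(5)[OF jp] by auto
      have tj: "?t ! j = tree s ! j" using jn by simp
      have ch: "nlo child = nlo (?t ! j)" "nhi child = nhi (?t ! j)" "nparent child = nparent (?t ! j)"
        "ndata child = data_in (dom_of child) (archive s)" "nsigma child = nsigma (?t ! j)"
        "dom_of child = dom_of (?t ! j)" "side child = side (tree s ! j)"
        unfolding tj by (auto simp: child revisit_def dom_of_def side_def fun_eq_iff)
      have gn: "good_node P child"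
        using gj(1) v by (auto simp: child revisit_def good_node_def dom_of_def data_in_def)
      have ys: "tree y = ?t[j := child]" "cur y = j" "pending y = pending s" "archive y = archive s"
        using y nr jl by auto
      have gt: "good_tree P (tree y) lab"
        unfolding ys by (rule good_tree_update[OF t' gn ch(1-3)])
      have "side child k \<le> rho P ^ length (lab j) * (upper P $ k - lower P $ k)" for k
        using gj(3) ch by simp
      moreover have "0 \<le> rho P ^ length (lab j)" "rho P ^ length (lab j) \<le> 1"
        using v by (auto intro: power_le_one)
      ultimately have "length (ndata child) \<le> crowd P"
        by (rule not_restart_cond(2)[OF P nr])
      then have "count_in (tree y) (archive y) (cur y) \<le> crowd P"
        using ch jl unfolding ys count_in_def by simp
      moreover have "sigma_crit P \<le> nsigma (tree y ! i)" if "i < length (tree y)" for i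
        unfolding ys using sg'[of i] ch(5) that ys(1) jl by (cases "i = j") auto
      moreover have "dom_of (tree y ! i) = dom_of (tree s ! i)" if "i < length (tree s)" for i
        unfolding ys using dm(1)[of i] ch(6) that by (cases "i = j") auto
      ultimately show ?thesis
        using gt lj jn jl ys by (intro disjI2 exI[of _ lab]) auto
    qed
  qed
qed

lemma update_state_simps:
  assumes "update_state P b nd c = (nd', k)"
  shows "nlo nd' = nlo nd" "nhi nd' = nhi nd" "nparent nd' = nparent nd" "ndata nd' = ndata nd"
    "nbeta nd' = nbeta nd" "nsigma nd' = nsigma nd \<or> nsigma nd' = nsigma nd / 2"
  using assms by (auto simp: update_state_def Let_def split: if_splits)

lemma srs_step_points:
  fixes P :: "('d :: finite) params"
  assumes inv: "inv_state P s lab" "pending s = []"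
    and st: "srs_step P f pool \<omega> q xc xs s y"
  shows "xc \<in> dom_of (cur_node s)" "length xs = npar P"
    "set xs \<subseteq> candidate (cur_node s) xc q ` {..<1000 * CARD('d)}"
proof -
  obtain nd' k where us: "update_state P
       (\<not> Min (snd ` set (evaluate f \<omega> xs)) < Min (snd ` set (archive s)))
       (cur_node s\<lparr>ndata := ndata (cur_node s) @ evaluate f \<omega> xs\<rparr>) (fails s) = (nd', k)"
    by fastforce
  obtain g where g: "xc \<in> lowest_fit g (ndata (cur_node s))"
    and sel: "srs_select P (flip s) g (candidate (cur_node s) xc q ` {..<1000 * CARD('d)})
              (fst ` set (archive s)) xs"
    using st us unfolding srs_step_def Let_def by auto
  have "good_node P (cur_node s)"
    using inv by (auto simp: inv_state_def good_treeD)
  with g show "xc \<in> dom_of (cur_node s)"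
    by (auto simp: lowest_fit_def good_node_def)
  show "length xs = npar P" "set xs \<subseteq> candidate (cur_node s) xc q ` {..<1000 * CARD('d)}"
    using sel by (auto simp: srs_select_def in_set_conv_nth)
qed

text \<open>Progress before the step is compared with \<open>occupancy\<close> after it, since the
  extra summand of \<open>progress\<close> depends on the node left current by the zoom-out
  decision, which is still open here.\<close>

lemma srs_step_cases:
  fixes P :: "('d :: finite) params"
  assumes P: "valid_params P" and inv: "inv_state P s lab" "pending s = []"
    and st: "srs_step P f pool \<omega> q xc xs s y"
    and u: "\<And>k. k < 1000 * CARD('d) \<Longrightarrow> fst (q k) \<in> cbox 0 1"
  shows "doe_start P pool y \<or>
    (\<exists>lab'. pending y = [] \<and> inv_state P y lab' \<and>
       progress P s \<le> occupancy P (tree y) (archive y) \<and>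
       (cur y = cur s \<and> lab' = lab \<or>
        cur y \<noteq> cur s \<and> length (lab' (cur y)) = Suc (length (lab (cur s))) \<and>
        count_in (tree y) (archive y) (cur y) \<le> crowd P))"
proof -
  let ?nd = "cur_node s" and ?new = "evaluate f \<omega> xs"
  note pt = srs_step_points[OF inv st]
  define b where "b \<longleftrightarrow> \<not> Min (snd ` set ?new) < Min (snd ` set (archive s))"
  obtain nd' k where us: "update_state P b (?nd\<lparr>ndata := ndata ?nd @ ?new\<rparr>) (fails s) = (nd', k)"
    by fastforce
  obtain g where
    y: "let s1 = s\<lparr>archive := archive s @ ?new, tree := (tree s)[cur s := nd'],
              fails := k, flip := \<not> flip s\<rparr> in
            if nsigma nd' < sigma_crit P then zoom_in P pool g s1 y else y = s1"
    using st us unfolding srs_step_def Let_def b_def[symmetric] by auto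
  note us' = update_state_simps[OF us, simplified]
  define s1 where "s1 = s\<lparr>archive := archive s @ ?new, tree := (tree s)[cur s := nd'],
              fails := k, flip := \<not> flip s\<rparr>"
  have y: "if nsigma nd' < sigma_crit P then zoom_in P pool g s1 y else y = s1"
    using y unfolding s1_def Let_def .
  have cur: "cur s < length (tree s)" and t: "good_tree P (tree s) lab"
    and sg: "\<And>i. i < length (tree s) \<Longrightarrow> sigma_crit P \<le> nsigma (tree s ! i)"
    and ar: "fst ` set (archive s) \<subseteq> cbox (lower P) (upper P)"
    using inv by (auto simp: inv_state_def)
  have v: "0 < sigma_crit P" "npar P \<ge> 1" using P by (auto simp: valid_params_def)
  have gn: "good_node P ?nd" using good_treeD(1)[OF t cur] .
  have xs: "set xs \<subseteq> dom_of ?nd"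
    using pt(3) candidate_in_dom[OF gn] u by fastforce
  have dD: "dom_of ?nd \<subseteq> cbox (lower P) (upper P)"
    using gn by (fastforce simp: good_node_def dom_of_def mem_box_cart intro: order_trans)
  have xne: "xs \<noteq> []" using pt(2) v by auto
  have dnd': "dom_of nd' = dom_of ?nd" using us' by (simp add: dom_of_def)
  have gn': "good_node P nd'"
    using gn us' xs sg[OF cur] v by (auto simp: good_node_def dom_of_def evaluate_simps image_Un)
  have t1: "good_tree P (tree s1) lab"
    unfolding s1_def by (simp, rule good_tree_update[OF t gn']) (use us' in auto)
  have s1: "cur s1 = cur s" "length (tree s1) = length (tree s)" "pending s1 = []"
    "archive s1 = archive s @ ?new"
    using inv by (auto simp: s1_def)
  have ar1: "fst ` set (archive s1) \<subseteq> cbox (lower P) (upper P)"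
    unfolding s1 using ar xs dD by (auto simp: image_Un evaluate_simps)
  have d1: "dom_of (tree s1 ! i) = dom_of (tree s ! i)" for i
    using dnd' cur by (cases "i = cur s") (auto simp: s1_def)
  have sg1: "sigma_crit P \<le> nsigma (tree s1 ! i)"
    if "i < length (tree s1)" "i \<noteq> cur s1 \<or> \<not> nsigma nd' < sigma_crit P" for i
    using that sg[of i] cur by (cases "i = cur s") (auto simp: s1_def)
  have prog: "progress P s \<le> occupancy P (tree y) (archive s @ ?new)"
    if "\<And>i. i < length (tree s) \<Longrightarrow> i < length (tree y) \<and> dom_of (tree y ! i) = dom_of (tree s ! i)"
    unfolding progress_def
    using that cur xne xs by (intro occupancy_append) (auto simp: evaluate_simps)
  show ?thesis
  proof (cases "nsigma nd' < sigma_crit P")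
    case True
    with y have z: "zoom_in P pool g s1 y" by simp
    have "cur s1 < length (tree s1)" using cur s1 by simp
    from zoom_in_cases[OF P t1 this sg1 z] consider "doe_start P pool y"
      | lab' where "pending y = pending s1" "archive y = archive s1"
       "cur y < length (tree y)" "good_tree P (tree y) lab'"
       "\<forall>i<length (tree y). sigma_crit P \<le> nsigma (tree y ! i)"
       "\<forall>i<length (tree s1). i < length (tree y) \<and> dom_of (tree y ! i) = dom_of (tree s1 ! i)"
       "cur y \<noteq> cur s1" "length (lab' (cur y)) = Suc (length (lab (cur s1)))"
       "count_in (tree y) (archive y) (cur y) \<le> crowd P"
      by blast
    then show ?thesis
    proof cases
      case 1
      then show ?thesis ..
    next
      case (2 lab')
      then have "progress P s \<le> occupancy P (tree y) (archive y)"
        using prog s1 d1 by auto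
      then show ?thesis
        using 2 s1 ar1 by (intro disjI2 exI[of _ lab']) (auto simp: inv_state_def)
    qed
  next
    case False
    with y have [simp]: "y = s1" by simp
    have "inv_state P s1 lab"
      using t1 ar1 sg1 False s1 cur by (auto simp: inv_state_def)
    moreover have "progress P s \<le> occupancy P (tree y) (archive y)"
      using prog s1 d1 by auto
    ultimately show ?thesis using s1 by auto
  qed
qed

lemma doe_start_inv:
  assumes P: "valid_params P" and s: "doe_start P pool s"
  shows "inv_state P s lab" "pending s \<noteq> []" "length (pending s) = ninit P"
proof -
  have lh: "latin_hypercube P (pending s)"
    using s by (auto simp: doe_start_def maximin_design_def)
  then show len: "length (pending s) = ninit P" by (simp add: latin_hypercube_def)
  have n: "ninit P \<ge> 1" using P by (simp add: valid_params_def)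
  with len show ne: "pending s \<noteq> []" by auto
  have "pending s ! k \<in> cbox (lower P) (upper P)" if k: "k < ninit P" for k
    unfolding mem_box_cart
  proof
    fix i
    let ?l = "upper P $ i - lower P $ i"
    obtain \<pi> where \<pi>: "bij_betw \<pi> {..<ninit P} {..<ninit P}"
      and x: "lower P $ i + real (\<pi> k) / real (ninit P) * ?l \<le> pending s ! k $ i"
        "pending s ! k $ i \<le> lower P $ i + real (\<pi> k + 1) / real (ninit P) * ?l"
      using lh k unfolding latin_hypercube_def by (meson atLeastAtMost_iff)
    have "\<pi> k < ninit P" using \<pi> k by (auto simp: bij_betw_def)
    then have "real (\<pi> k + 1) / real (ninit P) \<le> 1" by simp
    moreover have l: "0 < ?l" using P by (simp add: valid_params_def)
    ultimately have "real (\<pi> k + 1) / real (ninit P) * ?l \<le> 1 * ?l"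
      by (intro mult_right_mono) auto
    moreover have "0 \<le> real (\<pi> k) / real (ninit P) * ?l" using l by simp
    ultimately show "lower P $ i \<le> pending s ! k $ i \<and> pending s ! k $ i \<le> upper P $ i"
      using order_trans[OF _ x(1)] order_trans[OF x(2)] by simp
  qed
  with len have "set (pending s) \<subseteq> cbox (lower P) (upper P)"
    by (auto simp: in_set_conv_nth)
  with s ne len show "inv_state P s lab"
    by (auto simp: inv_state_def doe_start_def)
qed

lemma doe_step_inv:
  assumes P: "valid_params P" and inv: "inv_state P s lab" and p: "pending s \<noteq> []"
    and st: "doe_step P f \<omega> xs s y"
  shows "zoom_out v y = y" "inv_state P y (\<lambda>_. [])" "state_rank P y (\<lambda>_. []) < state_rank P s lab"
    "set xs \<subseteq> cbox (lower P) (upper P)"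
proof -
  let ?rest = "drop (npar P) (pending s)" and ?A = "archive s @ evaluate f \<omega> xs"
  have y: "y = s\<lparr>pending := ?rest, archive := ?A,
             tree := (if ?rest = [] then [fresh_node P ?A (lower P) (upper P) None] else [])\<rparr>"
    and xs: "xs = take (npar P) (pending s)"
    using st by (auto simp: doe_step_def Let_def)
  have i: "fst ` set (archive s) \<subseteq> cbox (lower P) (upper P)" "cur s = 0"
    "length (pending s) \<le> ninit P" "set (pending s) \<subseteq> cbox (lower P) (upper P)"
    using inv p by (auto simp: inv_state_def)
  have v: "npar P \<ge> 1" "\<And>i. lower P $ i < upper P $ i" "sigma_crit P \<le> sigma_init P"
    "beta_min P \<le> beta_init P" "res P < 1"
    using P by (auto simp: valid_params_def)
  show xs': "set xs \<subseteq> cbox (lower P) (upper P)"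
    using i xs set_take_subset by fastforce
  show "zoom_out v y = y"
    using i by (auto simp: y zoom_out_def fresh_node_def)
  have A: "fst ` set ?A \<subseteq> cbox (lower P) (upper P)"
    using i xs' by (auto simp: image_Un evaluate_simps)
  have r: "length ?rest < length (pending s)" "set ?rest \<subseteq> cbox (lower P) (upper P)"
    using v p i set_drop_subset[of "npar P" "pending s"] by (auto simp: Suc_le_eq)
  \<comment> \<open>The tree has at most one node, so a constant labelling is injective; the empty
    label is admissible because \<open>res P < 1\<close>.\<close>
  show "inv_state P y (\<lambda>_. [])"
    using A i r v
    by (auto simp: y inv_state_def good_tree_def good_node_def fresh_node_def dom_of_def labels_def
        side_def less_imp_le inj_on_def)
  show "state_rank P y (\<lambda>_. []) < state_rank P s lab"
    using i r p by (auto simp: y state_rank_def)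
qed

lemma iteration_points:
  fixes P :: "('d :: finite) params"
  assumes P: "valid_params P" and inv: "inv_state P s lab"
    and st: "iteration P f pool \<omega> q xc xs s y"
    and u: "\<And>k. k < 1000 * CARD('d) \<Longrightarrow> fst (q k) \<in> cbox 0 1"
  shows "set xs \<subseteq> cbox (lower P) (upper P)"
proof (cases "pending s = []")
  case True
  with st have st: "srs_step P f pool \<omega> q xc xs s y" by (simp add: iteration_def)
  have gn: "good_node P (cur_node s)"
    using inv True by (auto simp: inv_state_def good_treeD)
  have "set xs \<subseteq> dom_of (cur_node s)"
    using srs_step_points(3)[OF inv True st] candidate_in_dom[OF gn] u by fastforce
  also have "\<dots> \<subseteq> cbox (lower P) (upper P)"
    using gn by (fastforce simp: good_node_def dom_of_def mem_box_cart intro: order_trans)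
  finally show ?thesis .
next
  case False
  with st have "doe_step P f \<omega> xs s y" by (simp add: iteration_def)
  then show ?thesis by (rule doe_step_inv(4)[OF P inv False])
qed

text \<open>The thresholds for \<open>v\<close> work for every node: below \<open>beta_min P\<close>
  the zoom-out happens whatever \<open>nbeta\<close> is, and from \<open>beta_init P\<close> on it
  never does. The labelling is chosen anew after each iteration, as the tree may have grown or been
  discarded.\<close>

lemma iteration_inv:
  fixes P :: "('d :: finite) params"
  assumes P: "valid_params P" and inv: "inv_state P s lab"
    and st: "iteration P f pool \<omega> q xc xs s y"
    and u: "\<And>k. k < 1000 * CARD('d) \<Longrightarrow> fst (q k) \<in> cbox 0 1"
  shows "\<exists>lab'. inv_state P (zoom_out v y) lab' \<and>
     (state_rank P s lab \<noteq> 0 \<longrightarrow> (if cur y = cur s then v < beta_min P else beta_init P \<le> v) \<longrightarrow>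
      state_rank P (zoom_out v y) lab' < state_rank P s lab)"
proof (cases "pending s = []")
  case False
  with st have "doe_step P f \<omega> xs s y" by (simp add: iteration_def)
  note d = doe_step_inv[OF P inv False this]
  show ?thesis using d(1)[of v] d(2,3) by (intro exI[of _ "\<lambda>_. []"]) simp
next
  case True
  with st have st: "srs_step P f pool \<omega> q xc xs s y" by (simp add: iteration_def)
  from srs_step_cases[OF P inv True st u] consider
    "doe_start P pool y"
  | lab' where "pending y = []" "inv_state P y lab'"
       "progress P s \<le> occupancy P (tree y) (archive y)"
       "cur y = cur s" "lab' = lab"
  | lab' where "pending y = []" "inv_state P y lab'"
       "progress P s \<le> occupancy P (tree y) (archive y)"
       "cur y \<noteq> cur s" "length (lab' (cur y)) = Suc (length (lab (cur s)))"
       "count_in (tree y) (archive y) (cur y) \<le> crowd P"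
    by blast
  then show ?thesis
  proof cases
    case 1
    note d = doe_start_inv[OF P 1]
    have "zoom_out v y = y" using d by (simp add: zoom_out_def)
    \<comment> \<open>A restart has rank \<open>ninit P\<close>, just below the offset
      \<open>ninit P + 1\<close> in the rank of every state away from the root, whatever the coin
      shows.\<close>
    moreover have "state_rank P y lab < state_rank P s lab" if "state_rank P s lab \<noteq> 0"
      using that d True by (auto simp: state_rank_def split: if_splits)
    ultimately show ?thesis using d(1)[of lab] by auto
  next
    case (2 lab')
    have cy: "cur y < length (tree y)" and gt: "good_tree P (tree y) lab"
      using 2 by (auto simp: inv_state_def)
    show ?thesis
    proof (cases "nparent (cur_node y)")
      case None
      then have "zoom_out v y = y" by (simp add: zoom_out_def)
      \<comment> \<open>The current node was the root already, so the rank of \<open>s\<close> is 0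
        and no decrease is claimed.\<close>
      moreover have "cur y = 0" using good_treeD(4)[OF gt cy None] by simp
      ultimately show ?thesis using 2 True by (auto simp: state_rank_def)
    next
      case (Some j)
      note gj = good_treeD(5)[OF gt cy Some]
      have inv': "inv_state P (y\<lparr>cur := j\<rparr>) lab"
        using 2 gj by (auto simp: inv_state_def)
      have "state_rank P (y\<lparr>cur := j\<rparr>) lab < state_rank P s lab"
      proof -
        have "progress P s \<le> progress P (y\<lparr>cur := j\<rparr>)"
          using 2 by (simp add: progress_def)
        moreover have "Suc (length (lab j)) = length (lab (cur s))" "cur s \<noteq> 0"
          using gj 2(4) by auto
        ultimately show ?thesis using True 2(1) by (auto simp: state_rank_def)
      qed
      moreover have "v < nbeta (cur_node y)" if "v < beta_min P"
        using that good_treeD(1)[OF gt cy] by (auto simp: good_node_def)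
      ultimately show ?thesis
        using 2 inv' Some by (intro exI[of _ lab]) (auto simp: zoom_out_def)
    qed
  next
    case (3 lab')
    have cy: "cur y < length (tree y)" and gt: "good_tree P (tree y) lab'"
      using 3 by (auto simp: inv_state_def)
    have "inv_state P (zoom_out v y) lab'"
      using 3 good_treeD(5)[OF gt cy]
      by (fastforce simp: zoom_out_def inv_state_def split: option.splits)
    moreover have "state_rank P (zoom_out v y) lab' < state_rank P s lab"
      if "state_rank P s lab \<noteq> 0" "beta_init P \<le> v"
    proof -
      have "\<not> v < nbeta (cur_node y)"
        using that good_treeD(1)[OF gt cy] by (auto simp: good_node_def)
      then have "zoom_out v y = y" by (simp add: zoom_out_def split: option.splits)
      moreover have "progress P s < progress P y" using 3 by (simp add: progress_def)
      moreover have "progress P y \<le> progress_max P" using progress_le[OF P 3(2,1)] .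
      \<comment> \<open>The depth rises by 1 and \<open>progress\<close> by at least 1, which the
        factor 2 in the rank outweighs; the bound by \<open>progress_max P\<close> prevents
        truncated subtraction.\<close>
      ultimately show ?thesis using that True 3 by (auto simp: state_rank_def split: if_splits)
    qed
    ultimately show ?thesis using 3 by auto
  qed
qed

subsection \<open>Candidates near a given point\<close>

definition total_side :: "('d :: finite) params \<Rightarrow> real" where
  "total_side P = (\<Sum>i\<in>UNIV. upper P $ i - lower P $ i)"

text \<open>These are points of the unit cube that scaling to the whole domain sends within
  \<open>h\<close> of \<open>a\<close> in each coordinate: dividing by \<open>total_side P\<close>,
  a common upper bound of the sides, makes one half-width serve all of them.\<close>

definition target_cube :: "('d :: finite) params \<Rightarrow> 'd pt \<Rightarrow> real \<Rightarrow> 'd pt set" where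
  "target_cube P a h =
     (let c = (\<lambda>i. (a $ i - lower P $ i) / (upper P $ i - lower P $ i)) in
      cbox (\<chi> i. max 0 (c i - h / total_side P)) (\<chi> i. min 1 (c i + h / total_side P)))"

text \<open>A Gaussian displacement is scaled by deviation times side, at most
  \<open>sigma_init P * total_side P\<close>, so rounding by one grid step moves the candidate by at
  most \<open>h\<close>.\<close>

definition grid_step :: "('d :: finite) params \<Rightarrow> real \<Rightarrow> real" where
  "grid_step P h = h / (sigma_init P * total_side P)"

text \<open>At the root, \<open>a\<close> and \<open>xc\<close> differ by at most the side, so the
  displacement needed is at most 1/\<open>sigma_crit P\<close> in each coordinate; this is that
  bound in grid steps.\<close>

definition grid_bound :: "('d :: finite) params \<Rightarrow> real \<Rightarrow> int" where
  "grid_bound P h = \<lceil>1 / (sigma_crit P * grid_step P h)\<rceil>"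

text \<open>The Gaussian displacement that moves \<open>xc\<close> to \<open>a\<close> depends on the past; it is rounded to one
  of finitely many grid cells, so that independence of the draw from the past is only needed for
  fixed events.\<close>

definition grid_index ::
  "('d :: finite) params \<Rightarrow> 'd pt \<Rightarrow> real \<Rightarrow> 'd pt \<Rightarrow> real \<Rightarrow> 'd \<Rightarrow> int" where
  "grid_index P a h xc \<sigma> =
     (\<lambda>i. max (- grid_bound P h) (min (grid_bound P h)
        \<lfloor>(a $ i - xc $ i) / (\<sigma> * (upper P $ i - lower P $ i)) / grid_step P h\<rfloor>))"

definition grid_box :: "('d :: finite) params \<Rightarrow> real \<Rightarrow> ('d \<Rightarrow> int) \<Rightarrow> 'd pt set" where
  "grid_box P h v =
     cbox (\<chi> i. grid_step P h * of_int (v i)) (\<chi> i. grid_step P h * (of_int (v i) + 1))"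

text \<open>Constraining the uniform and the Gaussian part of each draw makes it irrelevant which
  type a candidate has and which candidates are selected.\<close>

definition draw_target ::
  "('d :: finite) params \<Rightarrow> 'd pt \<Rightarrow> real \<Rightarrow> ('d \<Rightarrow> int) \<Rightarrow> (nat \<Rightarrow> 'd pt \<times> 'd pt) set" where
  "draw_target P a h v =
     ({..<1000 * CARD('d)} \<rightarrow>\<^sub>E target_cube P a h \<times> grid_box P h v)"

lemma total_side_bounds:
  assumes "valid_params P"
  shows "0 < total_side P" "upper P $ i - lower P $ i \<le> total_side P"
proof -
  have l: "0 < upper P $ i - lower P $ i" for i using assms by (simp add: valid_params_def)
  show le: "upper P $ i - lower P $ i \<le> total_side P"
    unfolding total_side_def using l by (intro member_le_sum) (auto intro: less_imp_le)
  show "0 < total_side P" using l[of i] le by simp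
qed

lemma grid_step_pos:
  assumes "valid_params P" "0 < h"
  shows "0 < grid_step P h"
  using assms total_side_bounds(1)[OF assms(1)] by (auto simp: grid_step_def valid_params_def)

text \<open>Before projection either type is within \<open>h\<close> of \<open>a\<close> in each
  coordinate, and the l1 bound of the norm gives the factor d. Projection onto the closed convex
  domain does not increase the distance to \<open>a\<close>, which it fixes.\<close>

lemma root_candidate_near:
  fixes P :: "('d :: finite) params"
  assumes P: "valid_params P" and h: "0 < h"
    and nd: "nlo nd = lower P" "nhi nd = upper P" "sigma_crit P \<le> nsigma nd" "nsigma nd \<le> sigma_init P"
    and xc: "xc \<in> dom_of nd" and a: "a \<in> cbox (lower P) (upper P)"
    and q: "q \<in> draw_target P a h (grid_index P a h xc (nsigma nd))" and k: "k < 1000 * CARD('d)"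
  shows "dist (candidate nd xc q k) a \<le> real CARD('d) * h"
proof -
  let ?l = "\<lambda>i. upper P $ i - lower P $ i" and ?\<sigma> = "nsigma nd" and ?s = "grid_step P h"
  have l: "0 < ?l i" "0 < sigma_crit P" "sigma_crit P \<le> sigma_init P" for i
    using P by (auto simp: valid_params_def)
  have side: "side nd i = ?l i" for i using nd by (simp add: side_def)
  have \<sigma>: "0 < ?\<sigma>" using l nd by simp
  note sp = total_side_bounds[OF P] and s = grid_step_pos[OF P h]
  have dist: "dist x a \<le> real CARD('d) * h" if "\<And>i. \<bar>x $ i - a $ i\<bar> \<le> h" for x :: "'d pt"
  proof -
    have "norm (x - a) \<le> (\<Sum>i\<in>UNIV. \<bar>(x - a) $ i\<bar>)" by (rule norm_le_l1_cart)
    also have "\<dots> \<le> of_nat (card (UNIV :: 'd set)) * h"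
      using that by (intro sum_bounded_above) auto
    finally show ?thesis by (simp add: dist_norm)
  qed
  have u: "fst (q k) \<in> target_cube P a h" and z: "snd (q k) \<in> grid_box P h (grid_index P a h xc ?\<sigma>)"
    using q k by (auto simp: draw_target_def PiE_iff mem_Times_iff)
  have I: "\<bar>lower P $ i + fst (q k) $ i * ?l i - a $ i\<bar> \<le> h" for i
  proof -
    let ?c = "(a $ i - lower P $ i) / ?l i"
    have "\<bar>fst (q k) $ i - ?c\<bar> \<le> h / total_side P"
      using u unfolding target_cube_def Let_def mem_box_cart by (auto simp: abs_le_iff dest: spec[of _ i])
    then have "\<bar>fst (q k) $ i - ?c\<bar> * ?l i \<le> h / total_side P * ?l i"
      using l(1)[of i] by (intro mult_right_mono) auto
    also have "h / total_side P * ?l i \<le> h / total_side P * total_side P"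
      using sp h by (intro mult_left_mono) auto
    also have "\<dots> = h" using sp by simp
    also have "\<bar>fst (q k) $ i - ?c\<bar> * ?l i = \<bar>(fst (q k) $ i - ?c) * ?l i\<bar>"
      using l(1)[of i] by (simp add: abs_mult)
    also have "(fst (q k) $ i - ?c) * ?l i = lower P $ i + fst (q k) $ i * ?l i - a $ i"
      using l(1)[of i] by (simp add: field_simps)
    finally show ?thesis .
  qed
  have II: "\<bar>xc $ i + ?\<sigma> * ?l i * snd (q k) $ i - a $ i\<bar> \<le> h" for i
  proof -
    define t where "t = (a $ i - xc $ i) / (?\<sigma> * ?l i)"
    have "\<bar>a $ i - xc $ i\<bar> \<le> ?l i"
      using a xc nd unfolding dom_of_def mem_box_cart abs_le_iff by (smt (verit, best))
    then have "\<bar>t\<bar> \<le> 1 / ?\<sigma>"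
      using \<sigma> l(1)[of i] divide_right_mono[of "\<bar>a $ i - xc $ i\<bar>" "?l i" "?\<sigma> * ?l i"]
      by (simp add: t_def abs_mult)
    also have "\<dots> \<le> 1 / sigma_crit P" using nd l by (simp add: frac_le)
    finally have "\<bar>t / ?s\<bar> \<le> 1 / (sigma_crit P * ?s)"
      using s by (simp add: abs_divide field_simps)
    \<comment> \<open>At the root the clamping in \<open>grid_index\<close> is inactive, so the cell
      really contains the displacement \<open>t\<close>.\<close>
    then have "\<lfloor>t / ?s\<rfloor> \<le> grid_bound P h" "- grid_bound P h \<le> \<lfloor>t / ?s\<rfloor>"
      unfolding grid_bound_def by linarith+
    then have "grid_index P a h xc ?\<sigma> i = \<lfloor>t / ?s\<rfloor>"
      by (simp add: grid_index_def t_def)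
    then have "?s * of_int \<lfloor>t / ?s\<rfloor> \<le> snd (q k) $ i" "snd (q k) $ i \<le> ?s * (of_int \<lfloor>t / ?s\<rfloor> + 1)"
      using z unfolding grid_box_def mem_box_cart by (auto dest: spec[of _ i])
    moreover have "?s * of_int \<lfloor>t / ?s\<rfloor> \<le> ?s * (t / ?s)" "?s * (t / ?s) \<le> ?s * (of_int \<lfloor>t / ?s\<rfloor> + 1)"
      using s by (intro mult_left_mono; linarith)+
    moreover have "?s * (t / ?s) = t" using s by simp
    ultimately have "\<bar>snd (q k) $ i - t\<bar> \<le> ?s"
      by (simp add: algebra_simps abs_le_iff)
    then have "?\<sigma> * ?l i * \<bar>snd (q k) $ i - t\<bar> \<le> ?\<sigma> * ?l i * ?s"
      using \<sigma> l(1)[of i] by (intro mult_left_mono) auto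
    also have "\<dots> \<le> (sigma_init P * total_side P) * ?s"
      using \<sigma> l sp nd s by (intro mult_right_mono mult_mono) (auto intro: less_imp_le)
    also have "\<dots> = h" using sp l(2,3) by (simp add: grid_step_def)
    also have "?\<sigma> * ?l i * \<bar>snd (q k) $ i - t\<bar> = \<bar>?\<sigma> * ?l i * (snd (q k) $ i - t)\<bar>"
      using \<sigma> l(1)[of i] by (simp add: abs_mult)
    also have "?\<sigma> * ?l i * (snd (q k) $ i - t) = xc $ i + ?\<sigma> * ?l i * snd (q k) $ i - a $ i"
      using \<sigma> l(1)[of i] by (simp add: t_def field_simps)
    finally show ?thesis .
  qed
  have dom: "dom_of nd = cbox (lower P) (upper P)" using nd by (simp add: dom_of_def)
  have "dist (closest_point (dom_of nd) x) a \<le> dist x a" for x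
    using closest_point_lipschitz[of "dom_of nd" x a] a closest_point_self[of a "dom_of nd"]
    unfolding dom by (auto simp: closed_cbox convex_box)
  from this[THEN order_trans] show ?thesis
    unfolding candidate_def side nd(1) using dist I II by auto
qed

section \<open>Positive probability of the targets under the law of the draws\<close>

lemma emeasure_lborel_cbox_cart_pos:
  fixes a b :: "real ^ 'd"
  assumes "\<And>i. a $ i < b $ i"
  shows "0 < emeasure lborel (cbox a b)"
proof -
  have "0 < measure lborel (cbox a b)"
    using assms by (intro content_pos_lt) (auto simp: Basis_vec_def inner_axis)
  then show ?thesis
    by (simp add: measure_def enn2real_positive_iff)
qed

lemma sets_laws [measurable_cong, simp]:
  "sets (unit_cube_law :: (real ^ 'd :: finite) measure) = sets borel"
  "sets (std_gauss_law :: (real ^ 'd :: finite) measure) = sets borel"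
  by (simp_all add: unit_cube_law_def std_gauss_law_def)

lemma emeasure_unit_cube_law:
  fixes A :: "(real ^ 'd :: finite) set"
  assumes "A \<in> sets borel"
  shows "emeasure unit_cube_law A = emeasure lborel (cbox 0 1 \<inter> A)"
proof -
  have "emeasure lborel (cbox 0 (1 :: real ^ 'd)) = 1"
    by (subst emeasure_lborel_cbox_eq) (auto simp: Basis_vec_def inner_axis inner_diff_left
        intro!: prod.neutral)
  then show ?thesis
    using assms unfolding unit_cube_law_def
    by (subst emeasure_uniform_measure) (auto simp: divide_ennreal_def)
qed

lemma prob_space_unit_cube_law: "prob_space (unit_cube_law :: (real ^ 'd :: finite) measure)"
proof
  have "space unit_cube_law = (UNIV :: (real ^ 'd) set)"
    by (simp add: unit_cube_law_def)
  moreover have "emeasure lborel (cbox 0 (1 :: real ^ 'd)) = 1"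
    by (subst emeasure_lborel_cbox_eq) (auto simp: Basis_vec_def inner_axis inner_diff_left
        intro!: prod.neutral)
  ultimately show "emeasure unit_cube_law (space (unit_cube_law :: (real ^ 'd) measure)) = 1"
    by (simp add: emeasure_unit_cube_law)
qed

lemma gauss_density_measurable [measurable]:
  "(\<lambda>z :: real ^ 'd :: finite. \<Prod>i\<in>UNIV. ennreal (std_normal_density (z $ i))) \<in> borel_measurable borel"
  by measurable

text \<open>Finiteness of the density gives what the product formulas require of the Gaussian
  factor, without computing its total mass.\<close>

lemma sigma_finite_std_gauss_law: "sigma_finite_measure (std_gauss_law :: (real ^ 'd :: finite) measure)"
  unfolding std_gauss_law_def
  by (subst sigma_finite_measure.sigma_finite_iff_density_finite[OF sigma_finite_lborel])
    (auto simp: ennreal_prod_eq_top)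

lemma std_gauss_law_pos:
  fixes A :: "(real ^ 'd :: finite) set"
  assumes A: "A \<in> sets borel" "0 < emeasure lborel A"
  shows "0 < emeasure std_gauss_law A"
proof (rule ccontr)
  assume "\<not> 0 < emeasure std_gauss_law A"
  then have "A \<in> null_sets (std_gauss_law :: (real ^ 'd) measure)"
    using A by (auto simp: null_sets_def)
  then have "AE z in lborel. z \<in> A \<longrightarrow> (\<Prod>i\<in>UNIV. ennreal (std_normal_density (z $ i))) = 0"
    unfolding std_gauss_law_def by (subst (asm) null_sets_density_iff) auto
  moreover have "(\<Prod>i\<in>UNIV. ennreal (std_normal_density (z $ i))) \<noteq> 0" for z :: "real ^ 'd"
  proof -
    have "std_normal_density (z $ i) \<noteq> 0" for i
      using normal_density_pos[of 1 0 "z $ i"] by linarith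
    then show ?thesis by (simp add: not_le)
  qed
  ultimately have "AE z in lborel. z \<notin> A" by auto
  with A show False using AE_iff_null_sets[of A lborel] by (auto simp: null_sets_def)
qed

lemma emeasure_draw_law:
  fixes A :: "nat \<Rightarrow> ((real ^ 'd :: finite) \<times> (real ^ 'd)) set"
  assumes "\<And>k. k < 1000 * CARD('d) \<Longrightarrow> A k \<in> sets (borel \<Otimes>\<^sub>M borel)"
  shows "emeasure draw_law (\<Pi>\<^sub>E k\<in>{..<1000 * CARD('d)}. A k) =
         (\<Prod>k<1000 * CARD('d). emeasure (unit_cube_law \<Otimes>\<^sub>M std_gauss_law) (A k))"
proof -
  interpret U: prob_space "unit_cube_law :: (real ^ 'd) measure" by (rule prob_space_unit_cube_law)
  interpret product_sigma_finite
    "\<lambda>_ :: nat. (unit_cube_law \<Otimes>\<^sub>M std_gauss_law) :: ((real ^ 'd) \<times> (real ^ 'd)) measure"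
    unfolding product_sigma_finite_def
    using sigma_finite_pair_measure[OF U.sigma_finite_measure_axioms sigma_finite_std_gauss_law]
    by blast
  have "sets (unit_cube_law \<Otimes>\<^sub>M std_gauss_law) =
      sets (borel \<Otimes>\<^sub>M borel :: ((real ^ 'd) \<times> (real ^ 'd)) measure)"
    by (intro sets_pair_measure_cong) simp_all
  then show ?thesis
    unfolding draw_law_def using assms by (intro emeasure_PiM) auto
qed

lemma emeasure_cube_gauss_Times:
  fixes A B :: "(real ^ 'd :: finite) set"
  assumes "A \<in> sets borel" "B \<in> sets borel"
  shows "emeasure (unit_cube_law \<Otimes>\<^sub>M std_gauss_law) (A \<times> B) =
         emeasure lborel (cbox 0 1 \<inter> A) * emeasure std_gauss_law B"
  using assms by (simp add: sigma_finite_measure.emeasure_pair_measure_Times[OF sigma_finite_std_gauss_law]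
      emeasure_unit_cube_law)

lemma draw_target_sets:
  fixes P :: "('d :: finite) params"
  shows "draw_target P a h v \<in> sets draw_space"
  unfolding draw_target_def draw_space_def target_cube_def grid_box_def Let_def
  by (intro sets_PiM_I_finite pair_measureI) auto

lemma draw_target_pos:
  fixes P :: "('d :: finite) params"
  assumes P: "valid_params P" and h: "0 < h" and a: "a \<in> cbox (lower P) (upper P)"
  shows "0 < emeasure draw_law (draw_target P a h v)"
proof -
  have "emeasure draw_law (draw_target P a h v) =
      (\<Prod>k<1000 * CARD('d). emeasure (unit_cube_law \<Otimes>\<^sub>M std_gauss_law)
         (target_cube P a h \<times> grid_box P h v))"
    unfolding draw_target_def
    by (subst emeasure_draw_law) (auto simp: target_cube_def grid_box_def Let_def intro!: pair_measureI)
  also have "\<dots> = (\<Prod>k<1000 * CARD('d). emeasure lborel (cbox 0 1 \<inter> target_cube P a h) *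
       emeasure std_gauss_law (grid_box P h v))"
    by (subst emeasure_cube_gauss_Times) (auto simp: target_cube_def grid_box_def Let_def)
  also have "\<dots> > 0"
  proof -
    have l: "0 < upper P $ i - lower P $ i" for i using P by (simp add: valid_params_def)
    have hs: "0 < h / total_side P" using h total_side_bounds(1)[OF P] by simp
    define c where "c i = (a $ i - lower P $ i) / (upper P $ i - lower P $ i)" for i
    \<comment> \<open>With the centre in [0,1], truncation to the unit cube leaves a nondegenerate
      interval in every coordinate.\<close>
    have c: "0 \<le> c i" "c i \<le> 1" for i
      using a l[of i] by (auto simp: c_def mem_box_cart)
    have "target_cube P a h \<subseteq> cbox 0 1"
      by (auto simp: target_cube_def Let_def mem_box_cart)
    then have "cbox 0 1 \<inter> target_cube P a h = target_cube P a h" by blast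
    moreover have "0 < emeasure lborel (target_cube P a h)"
      unfolding target_cube_def Let_def c_def[symmetric]
    proof (intro emeasure_lborel_cbox_cart_pos)
      fix i
      show "(\<chi> i. max 0 (c i - h / total_side P)) $ i < (\<chi> i. min 1 (c i + h / total_side P)) $ i"
        using c[of i] hs by (simp add: max_def min_def)
    qed
    moreover have "0 < emeasure std_gauss_law (grid_box P h v)"
      unfolding grid_box_def using grid_step_pos[OF P h]
      by (intro std_gauss_law_pos emeasure_lborel_cbox_cart_pos) auto
    ultimately have "(\<Prod>k<n. emeasure lborel (cbox 0 1 \<inter> target_cube P a h) *
       emeasure std_gauss_law (grid_box P h v)) \<noteq> 0" for n :: nat
      by auto
    then show ?thesis using zero_less_iff_neq_zero by blast
  qed
  finally show ?thesis .
qed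

text \<open>The failure for one index lies in a product set with a factor of measure 0. The pathwise
  invariants hold on the almost sure event that all uniform draws lie in the cube.\<close>

lemma AE_draw_law_cube:
  "AE q in (draw_law :: (nat \<Rightarrow> (real ^ 'd :: finite) \<times> (real ^ 'd)) measure).
     \<forall>k<1000 * CARD('d). fst (q k) \<in> cbox 0 1"
proof -
  let ?K = "1000 * CARD('d)"
  have "AE q in (draw_law :: (nat \<Rightarrow> (real ^ 'd) \<times> (real ^ 'd)) measure). fst (q k) \<in> cbox 0 1"
    if k: "k < ?K" for k
  proof -
    let ?A = "\<lambda>j. if j = k then (- cbox 0 (1 :: real ^ 'd)) \<times> (UNIV :: (real ^ 'd) set) else UNIV"
    have sp: "space (draw_law :: (nat \<Rightarrow> (real ^ 'd) \<times> (real ^ 'd)) measure) = ({..<?K} \<rightarrow>\<^sub>E UNIV)"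
      by (simp add: draw_law_def space_PiM space_pair_measure unit_cube_law_def std_gauss_law_def)
    have A: "?A j \<in> sets (borel \<Otimes>\<^sub>M borel)" for j
      using sets.top[of "borel \<Otimes>\<^sub>M borel :: ((real ^ 'd) \<times> (real ^ 'd)) measure"]
      by (auto intro!: pair_measureI simp: space_pair_measure)
    have "emeasure draw_law (\<Pi>\<^sub>E j\<in>{..<?K}. ?A j) =
       (\<Prod>j<?K. emeasure (unit_cube_law \<Otimes>\<^sub>M std_gauss_law) (?A j))"
      by (rule emeasure_draw_law) (rule A)
    also have "\<dots> = 0"
      using k by (intro prod_zero) (auto simp: emeasure_cube_gauss_Times intro!: bexI[of _ k])
    finally have "emeasure draw_law (\<Pi>\<^sub>E j\<in>{..<?K}. ?A j) = 0" .
    moreover have "(\<Pi>\<^sub>E j\<in>{..<?K}. ?A j) \<in> sets draw_law"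
      using A unfolding draw_law_def by (intro sets_PiM_I_finite)
        (auto simp: sets_pair_measure_cong[OF sets_laws])
    ultimately have "(\<Pi>\<^sub>E j\<in>{..<?K}. ?A j) \<in> null_sets draw_law" by (rule null_setsI)
    moreover have "{q \<in> space draw_law. fst (q k) \<notin> cbox 0 1} \<subseteq> (\<Pi>\<^sub>E j\<in>{..<?K}. ?A j)"
    proof
      fix q :: "nat \<Rightarrow> (real ^ 'd) \<times> (real ^ 'd)"
      assume q: "q \<in> {q \<in> space draw_law. fst (q k) \<notin> cbox 0 1}"
      show "q \<in> (\<Pi>\<^sub>E j\<in>{..<?K}. ?A j)"
      proof (rule PiE_I)
        show "q j \<in> ?A j" for j using q by (cases "j = k") (auto simp: mem_Times_iff)
        show "q j = undefined" if "j \<notin> {..<?K}" for j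
          using q that unfolding sp by (blast dest: PiE_arb)
      qed
    qed
    ultimately show ?thesis by (rule AE_I')
  qed
  then have "AE q in (draw_law :: (nat \<Rightarrow> (real ^ 'd) \<times> (real ^ 'd)) measure).
      \<forall>k\<in>{..<?K}. fst (q k) \<in> cbox 0 1"
    by (intro AE_finite_allI) auto
  then show ?thesis by (simp only: lessThan_iff Ball_def)
qed

subsection \<open>Blocks of good iterations\<close>

context prob_space
begin

text \<open>This replaces conditioning on the past. The target \<open>D (g w)\<close> depends on the
  past only through \<open>g\<close>, which takes finitely many values; splitting by them leaves
  fixed events, to which independence applies.\<close>

lemma indep_set_partition:
  assumes sub: "sets H \<subseteq> events" and fin: "finite I"
    and g: "\<And>w. w \<in> space M \<Longrightarrow> g w \<in> I" "\<And>v. v \<in> I \<Longrightarrow> {w \<in> space M. g w = v} \<in> sets H"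
    and indep: "indep_set (sets H) C"
    and D: "\<And>v. v \<in> I \<Longrightarrow> D v \<in> C" "\<And>v. v \<in> I \<Longrightarrow> \<delta> \<le> prob (D v)"
    and E: "E \<in> sets H"
  shows "\<delta> * prob E \<le> prob (E \<inter> {w \<in> space M. w \<in> D (g w)})"
proof -
  let ?G = "\<lambda>v. E \<inter> {w \<in> space M. g w = v}"
  have C: "C \<subseteq> events" using indep by (auto simp: indep_set_def indep_sets_def UNIV_bool)
  have EM: "E \<subseteq> space M" using E sub sets.sets_into_space by blast
  have G: "?G v \<in> sets H" if "v \<in> I" for v using E g(2)[OF that] by blast
  have ev: "?G v \<in> events" "?G v \<inter> D v \<in> events" if "v \<in> I" for v
    using G[OF that] sub D(1)[OF that] C by auto
  have "prob E = prob (\<Union>v\<in>I. ?G v)"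
    using g(1) EM by (intro arg_cong[of _ _ prob]) blast
  also have "\<dots> = (\<Sum>v\<in>I. prob (?G v))"
    using fin ev by (intro finite_measure_finite_Union) (auto simp: disjoint_family_on_def)
  finally have "\<delta> * prob E = (\<Sum>v\<in>I. prob (?G v) * \<delta>)"
    by (simp add: sum_distrib_left mult.commute)
  also have "\<dots> \<le> (\<Sum>v\<in>I. prob (?G v) * prob (D v))"
    using D(2) by (intro sum_mono mult_left_mono) auto
  also have "\<dots> = (\<Sum>v\<in>I. prob (?G v \<inter> D v))"
    using G D(1) by (intro sum.cong refl indep_setD[OF indep, symmetric])
  also have "\<dots> = prob (\<Union>v\<in>I. ?G v \<inter> D v)"
    using fin ev by (intro finite_measure_finite_Union[symmetric]) (auto simp: disjoint_family_on_def)
  also have "(\<Union>v\<in>I. ?G v \<inter> D v) = E \<inter> {w \<in> space M. w \<in> D (g w)}"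
    using g(1) EM by blast
  finally show ?thesis .
qed

text \<open>The last hypothesis says that \<open>G n\<close> has conditional probability at least
  \<open>\<delta>\<close> given \<open>H n\<close>. Hence a block of length \<open>L\<close> is good
  throughout with conditional probability at least \<open>\<delta> ^ L\<close>, and the first j
  disjoint blocks all fail with probability at most \<open>(1 - \<delta> ^ L) ^ j\<close>.\<close>

lemma AE_exists_good_block:
  fixes H :: "nat \<Rightarrow> 'a measure"
  assumes sub: "\<And>n. sets (H n) \<subseteq> events" and mono: "\<And>n. sets (H n) \<subseteq> sets (H (Suc n))"
    and top: "space M \<in> sets (H 0)"
    and G: "\<And>n. G n \<in> sets (H (Suc n))"
    and \<delta>: "0 < \<delta>" "\<And>n E. E \<in> sets (H n) \<Longrightarrow> \<delta> * prob E \<le> prob (E \<inter> G n)"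
  shows "AE w in M. \<exists>n. \<forall>k<L. w \<in> G (n + k)"
proof -
  define B where "B n j = {w \<in> space M. \<forall>k<j. w \<in> G (n + k)}" for n j
  have chain: "sets (H n) \<subseteq> sets (H (n + j))" for n j
  proof (induction j)
    case (Suc j)
    show ?case unfolding add_Suc_right by (rule order_trans[OF Suc mono])
  qed simp
  have topn: "space M \<in> sets (H n)" for n using subsetD[OF chain top, of n] by simp
  have Bsuc: "B n (Suc j) = B n j \<inter> G (n + j)" for n j
    by (auto simp: B_def less_Suc_eq)
  have BH: "B n j \<in> sets (H (n + j))" for n j
  proof (induction j)
    case 0
    then show ?case using topn by (simp add: B_def)
  next
    case (Suc j)
    then have "B n j \<in> sets (H (Suc (n + j)))" by (rule subsetD[OF mono])
    then show ?case unfolding Bsuc using G[of "n + j"] by (simp add: sets.Int)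
  qed
  have step: "\<delta> ^ j * prob E \<le> prob (E \<inter> B n j)" if E: "E \<in> sets (H n)" for E n j
  proof (induction j)
    case 0
    have "E \<subseteq> space M" by (rule sets.sets_into_space[OF subsetD[OF sub E]])
    then have "E \<inter> B n 0 = E" by (auto simp: B_def)
    then show ?case by simp
  next
    case (Suc j)
    have "E \<inter> B n j \<in> sets (H (n + j))" using subsetD[OF chain E] BH by (rule sets.Int)
    from \<delta>(2)[OF this] have "\<delta> * prob (E \<inter> B n j) \<le> prob (E \<inter> B n (Suc j))"
      by (simp add: Bsuc Int_assoc)
    moreover have "\<delta> * (\<delta> ^ j * prob E) \<le> \<delta> * prob (E \<inter> B n j)"
      using Suc \<delta>(1) by (intro mult_left_mono) auto
    ultimately show ?case by (simp add: mult.assoc)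
  qed
  define F where "F j = {w \<in> space M. \<forall>i<j. w \<notin> B (i * L) L}" for j
  have Fsuc: "F (Suc j) = F j - (F j \<inter> B (j * L) L)" for j
    by (auto simp: F_def less_Suc_eq)
  have FH: "F j \<in> sets (H (j * L))" for j
  proof (induction j)
    case 0
    then show ?case using topn by (simp add: F_def)
  next
    case (Suc j)
    have "F j \<in> sets (H (j * L + L))" by (rule subsetD[OF chain Suc])
    then have "F (Suc j) \<in> sets (H (j * L + L))" unfolding Fsuc using BH[of "j * L" L] by auto
    then show ?case by (simp add: add.commute)
  qed
  \<comment> \<open>The block estimate on the whole space shows that the ratio
    \<open>1 - \<delta> ^ L\<close> is nonnegative, as the induction below needs.\<close>
  have q: "\<delta> ^ L \<le> 1"
    using order_trans[OF step[OF topn, of L 0] prob_le_1] prob_space by simp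
  have F: "prob (F j) \<le> (1 - \<delta> ^ L) ^ j" for j
  proof (induction j)
    case 0
    then show ?case by simp
  next
    case (Suc j)
    have ev: "F j \<in> events" "F j \<inter> B (j * L) L \<in> events"
      using subsetD[OF sub FH[of j]] subsetD[OF sub BH[of "j * L" L]] by (auto intro: sets.Int)
    have "prob (F (Suc j)) = prob (F j) - prob (F j \<inter> B (j * L) L)"
      unfolding Fsuc using ev by (intro finite_measure_Diff) auto
    also have "\<dots> \<le> (1 - \<delta> ^ L) * prob (F j)"
      using step[OF FH, of L j] by (simp add: algebra_simps)
    also have "\<dots> \<le> (1 - \<delta> ^ L) * (1 - \<delta> ^ L) ^ j"
      using Suc q by (intro mult_left_mono) auto
    finally show ?case by simp
  qed
  have Fe: "F j \<in> events" for j by (rule subsetD[OF sub FH])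
  define N where "N = (\<Inter>j. F j)"
  have Ne: "N \<in> events" unfolding N_def using Fe by auto
  have "prob N \<le> (1 - \<delta> ^ L) ^ j" for j
    using finite_measure_mono[of N "F j"] Fe F[of j] by (force simp: N_def)
  moreover have "(\<lambda>j. (1 - \<delta> ^ L) ^ j) \<longlonglongrightarrow> 0"
    using q \<delta>(1) by (intro LIMSEQ_power_zero) (auto simp: abs_if)
  ultimately have "prob N \<le> 0" by (intro LIMSEQ_le_const) auto
  then have "N \<in> null_sets M"
    using Ne by (auto simp: null_sets_def emeasure_eq_measure ennreal_eq_0_iff)
  moreover have "{w \<in> space M. \<not> (\<exists>n. \<forall>k<L. w \<in> G (n + k))} \<subseteq> N"
    by (auto simp: N_def F_def B_def)
  ultimately show ?thesis by (rule AE_I')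
qed

end

subsection \<open>Measurability of the state\<close>

lemma space_list_space_UNIV: "space A = UNIV \<Longrightarrow> space (list_space A) = UNIV"
  by (simp add: list_space_def space_measure_of_conv)

text \<open>Splitting by length reduces the preimage to generators. The tree is empty during the
  design phase, and \<open>[] ! 0\<close> is a fixed though unspecified value, so the singleton of
  the empty list is added or left out as a whole.\<close>

lemma nth_0_measurable_list_space:
  assumes A: "space A = UNIV"
  shows "(\<lambda>xs. xs ! 0) \<in> measurable (list_space A) A"
proof (rule measurableI)
  fix S assume S: "S \<in> sets A"
  have gen: "sets (list_space A) = sigma_sets UNIV
     {{xs. length xs = n \<and> (\<forall>i<n. xs ! i \<in> B i)} | n B. \<forall>i<n. B i \<in> sets A}"
    using A by (simp add: list_space_def sets_measure_of)
  have basic: "{xs. length xs = n \<and> (\<forall>i<n. xs ! i \<in> B i)} \<in> sets (list_space A)"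
    if "\<And>i. i < n \<Longrightarrow> B i \<in> sets A" for n B
    unfolding gen using that by (intro sigma_sets.Basic) blast
  have top: "UNIV \<in> sets A" using sets.top[of A] A by simp
  have "{xs. length xs = Suc n \<and> xs ! 0 \<in> S} \<in> sets (list_space A)" for n
  proof -
    have "{xs. length xs = Suc n \<and> xs ! 0 \<in> S} =
        {xs. length xs = Suc n \<and> (\<forall>i<Suc n. xs ! i \<in> (if i = 0 then S else UNIV))}"
      by auto
    also have "\<dots> \<in> sets (list_space A)" using S top by (intro basic) auto
    finally show ?thesis .
  qed
  then have "(\<Union>n. {xs. length xs = Suc n \<and> xs ! 0 \<in> S}) \<in> sets (list_space A)" by auto
  moreover have "(if [] ! 0 \<in> S then {[]} else {}) \<in> sets (list_space A)"
    using basic[of 0] by auto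
  moreover have "(\<lambda>xs. xs ! 0) -` S \<inter> space (list_space A) =
      (\<Union>n. {xs. length xs = Suc n \<and> xs ! 0 \<in> S}) \<union> (if [] ! 0 \<in> S then {[]} else {})"
  proof (rule set_eqI)
    fix xs show "xs \<in> (\<lambda>xs. xs ! 0) -` S \<inter> space (list_space A) \<longleftrightarrow> xs \<in>
      (\<Union>n. {xs. length xs = Suc n \<and> xs ! 0 \<in> S}) \<union> (if [] ! 0 \<in> S then {[]} else {})"
      using space_list_space_UNIV[OF A] by (cases xs) auto
  qed
  ultimately show "(\<lambda>xs. xs ! 0) -` S \<inter> space (list_space A) \<in> sets (list_space A)" by auto
qed (use A in simp)

lemma space_state_spaces [simp]:
  "space evals_space = UNIV" "space node_space = UNIV" "space astate_space = UNIV"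
  by (simp_all add: evals_space_def space_list_space_UNIV space_pair_measure node_space_def astate_space_def)

lemma nsigma_measurable: "nsigma \<in> borel_measurable node_space"
proof -
  let ?f = "\<lambda>nd :: 'a node. (ndata nd, nlo nd, nhi nd, ngamma nd, np nd, nsigma nd, nbeta nd, nparent nd)"
  have f: "?f \<in> measurable node_space
     (evals_space \<Otimes>\<^sub>M borel \<Otimes>\<^sub>M borel \<Otimes>\<^sub>M borel \<Otimes>\<^sub>M borel \<Otimes>\<^sub>M borel \<Otimes>\<^sub>M borel \<Otimes>\<^sub>M count_space UNIV)"
    unfolding node_space_def by (rule measurable_vimage_algebra1) (simp add: space_pair_measure)
  have "(\<lambda>nd. fst (snd (snd (snd (snd (snd (?f nd))))))) \<in> borel_measurable node_space"
    by (rule measurable_compose[OF f], measurable)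
  then show ?thesis by simp
qed

lemma astate_measurable:
  "cur \<in> measurable (astate_space :: ('d :: finite) astate measure) (count_space UNIV)"
  "tree \<in> measurable (astate_space :: ('d :: finite) astate measure) (list_space node_space)"
proof -
  let ?f = "\<lambda>s :: 'd astate. (pending s, archive s, tree s, cur s, fails s, flip s)"
  have f: "?f \<in> measurable astate_space
     (list_space borel \<Otimes>\<^sub>M evals_space \<Otimes>\<^sub>M list_space node_space \<Otimes>\<^sub>M
      count_space UNIV \<Otimes>\<^sub>M count_space UNIV \<Otimes>\<^sub>M count_space UNIV)"
    unfolding astate_space_def
    by (rule measurable_vimage_algebra1) (simp add: space_pair_measure space_list_space_UNIV)
  have "(\<lambda>s. fst (snd (snd (snd (?f s))))) \<in> measurable astate_space (count_space UNIV)"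
    by (rule measurable_compose[OF f], measurable)
  then show "cur \<in> measurable (astate_space :: 'd astate measure) (count_space UNIV)" by simp
  have "(\<lambda>s. fst (snd (snd (?f s)))) \<in> measurable astate_space (list_space node_space)"
    by (rule measurable_compose[OF f], measurable)
  then show "tree \<in> measurable (astate_space :: 'd astate measure) (list_space node_space)" by simp
qed

lemma root_sigma_measurable:
  "(\<lambda>s. nsigma (tree s ! 0)) \<in> borel_measurable (astate_space :: ('d :: finite) astate measure)"
  by (rule measurable_compose[OF astate_measurable(2)
        measurable_compose[OF nth_0_measurable_list_space nsigma_measurable]]) simp

subsection \<open>Convergence\<close>

context prosrs_run
begin

definition grid_cells :: "real \<Rightarrow> ('d \<Rightarrow> int) set" where
  "grid_cells h = (UNIV \<rightarrow>\<^sub>E {- grid_bound P h..grid_bound P h})"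

text \<open>The deviation is always that of node 0, current or not. The event thus makes sense, with
  a uniform bound, in every iteration; it forces candidates towards \<open>a\<close> when the root
  is current.\<close>

definition draw_good :: "'d pt \<Rightarrow> real \<Rightarrow> nat \<Rightarrow> 'w set" where
  "draw_good a h n = {w \<in> space M.
     draw n w \<in> draw_target P a h (grid_index P a h (xc n w) (nsigma (tree (X n w) ! 0)))}"

text \<open>Fixed thresholds instead of \<open>nbeta\<close> leave just two coin events, and the
  choice between them is known before the coin is tossed.\<close>

definition coin_good :: "nat \<Rightarrow> 'w set" where
  "coin_good n = {w \<in> space M.
     if cur (Y n w) = cur (X n w) then coin n w < beta_min P else beta_init P \<le> coin n w}"

lemma subalgebra_sets: "sets (hist n) \<subseteq> events" "sets (mid n) \<subseteq> events"
    "sets (hist n) \<subseteq> sets (mid n)" "sets (mid n) \<subseteq> sets (hist (Suc n))"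
  and subalgebra_space: "space (hist n) = space M" "space (mid n) = space M"
  using hist_sub[of n] mid_sub[of n] hist_mid[of n] mid_hist[of n] by (auto simp: subalgebra_def)

lemma draw_measurable: "draw n \<in> measurable M draw_space"
  by (rule measurable_from_subalg[OF mid_sub draw_mid])

lemma AE_draw_cube: "AE w in M. \<forall>n. \<forall>k<1000 * CARD('d). fst (draw n w k) \<in> cbox 0 1"
proof -
  have "AE w in M. \<forall>k<1000 * CARD('d). fst (draw n w k) \<in> cbox 0 1" for n
    using AE_draw_law_cube[where 'd = 'd, folded draw_distr[of n]] draw_measurable
    by (rule AE_distrD[rotated])
  then show ?thesis by (simp only: AE_all_countable) blast
qed

lemma prob_draw_target:
  "prob (draw n -` draw_target P a h v \<inter> space M) = measure draw_law (draw_target P a h v)"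
  unfolding draw_distr[of n, symmetric]
  by (rule measure_distr[OF draw_measurable draw_target_sets, symmetric])

lemma finite_grid_cells: "finite (grid_cells h)"
  unfolding grid_cells_def by (intro finite_PiE) auto

text \<open>Clamping gives this for arbitrary \<open>x\<close> and \<open>\<sigma>\<close>, hence
  also in iterations away from the root, so finitely many targets suffice throughout.\<close>

lemma grid_index_in_cells:
  assumes "0 < h"
  shows "grid_index P a h x \<sigma> \<in> grid_cells h"
proof -
  have "0 \<le> 1 / (sigma_crit P * grid_step P h)"
    using grid_step_pos[OF params assms] params by (auto simp: valid_params_def)
  then have "0 \<le> grid_bound P h" unfolding grid_bound_def by linarith
  then show ?thesis by (auto simp: grid_index_def grid_cells_def)
qed

lemma draw_good_prob:
  assumes h: "0 < h" and a: "a \<in> cbox (lower P) (upper P)"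
  obtains \<epsilon> where "0 < \<epsilon>"
    "\<And>n E. E \<in> sets (hist n) \<Longrightarrow> \<epsilon> * prob E \<le> prob (E \<inter> draw_good a h n)"
    "\<And>n. draw_good a h n \<in> sets (mid n)"
proof -
  let ?D = "\<lambda>n v. draw n -` draw_target P a h v \<inter> space M"
  let ?g = "\<lambda>n w. grid_index P a h (xc n w) (nsigma (tree (X n w) ! 0))"
  \<comment> \<open>A minimum over finitely many cells, each of positive probability; it depends
    neither on the iteration nor on the past.\<close>
  define \<epsilon> where "\<epsilon> = Min ((\<lambda>v. measure draw_law (draw_target P a h v)) ` grid_cells h)"
  have ne: "grid_cells h \<noteq> {}" using grid_index_in_cells[OF h] by blast
  have pos: "0 < measure draw_law (draw_target P a h v)" for v
  proof -
    \<comment> \<open>As the distribution of an actual draw, the law is finite, so positivity passes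
      from \<open>emeasure\<close> to the real-valued \<open>measure\<close>.\<close>
    have "emeasure M (?D 0 v) = emeasure draw_law (draw_target P a h v)"
      unfolding draw_distr[of 0, symmetric]
      by (rule emeasure_distr[OF draw_measurable draw_target_sets, symmetric])
    then have "0 < emeasure M (?D 0 v)" using draw_target_pos[OF params h a, of v] by simp
    then show ?thesis
      unfolding prob_draw_target[of 0, symmetric] by (simp add: emeasure_eq_measure)
  qed
  have "0 < \<epsilon>" unfolding \<epsilon>_def using finite_grid_cells ne pos by (subst Min_gr_iff) auto
  have good: "draw_good a h n = {w \<in> space M. w \<in> ?D n (?g n w)}" for n
    by (auto simp: draw_good_def)
  have g: "{w \<in> space M. ?g n w = v} \<in> sets (hist n)" for n v
  proof -
    have "(\<lambda>w. nsigma (tree (X n w) ! 0)) \<in> borel_measurable (hist n)"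
      by (rule measurable_compose[OF X_hist root_sigma_measurable])
    moreover have "(\<lambda>w. xc n w $ i) \<in> borel_measurable (hist n)" for i
      by (rule measurable_compose[OF xc_hist])
        (intro borel_measurable_continuous_onI continuous_intros)
    ultimately have "(\<lambda>w. ?g n w i) \<in> measurable (hist n) (count_space UNIV)" for i
      unfolding grid_index_def by measurable
    then have "{w \<in> space (hist n). \<forall>i. ?g n w i = v i} \<in> sets (hist n)"
      by measurable
    then show ?thesis by (simp add: subalgebra_space fun_eq_iff)
  qed
  have D: "?D n v \<in> sets (vimage_algebra (space M) (draw n) draw_space)" for n v
    by (rule in_vimage_algebra[OF draw_target_sets])
  have prob: "\<epsilon> * prob E \<le> prob (E \<inter> draw_good a h n)" if "E \<in> sets (hist n)" for E n
    unfolding good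
  proof (rule indep_set_partition[OF subalgebra_sets(1) finite_grid_cells grid_index_in_cells[OF h]
        g draw_fresh D _ that])
    fix v assume "v \<in> grid_cells h"
    then show "\<epsilon> \<le> prob (?D n v)"
      unfolding \<epsilon>_def prob_draw_target using finite_grid_cells by (intro Min_le) auto
  qed
  have "draw_good a h n \<in> sets (mid n)" for n
  proof -
    have "draw_good a h n = (\<Union>v\<in>grid_cells h. {w \<in> space M. ?g n w = v} \<inter> ?D n v)"
      unfolding good using grid_index_in_cells[OF h] by blast
    also have "\<dots> \<in> sets (mid n)"
    proof (rule sets.finite_UN[OF finite_grid_cells])
      fix v
      have "?D n v \<in> sets (mid n)"
        using measurable_sets[OF draw_mid[of n] draw_target_sets[of P a h v]]
        by (simp add: subalgebra_space)
      with subsetD[OF subalgebra_sets(3) g] show "{w \<in> space M. ?g n w = v} \<inter> ?D n v \<in> sets (mid n)"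
        by (rule sets.Int)
    qed
    finally show ?thesis .
  qed
  with \<open>0 < \<epsilon>\<close> prob that show thesis by blast
qed

lemma coin_good_prob:
  assumes "E \<in> sets (mid n)"
  shows "min (beta_min P) (1 - beta_init P) * prob E \<le> prob (E \<inter> coin_good n)"
    and "coin_good n \<in> sets (hist (Suc n))"
proof -
  let ?g = "\<lambda>w. cur (Y n w) = cur (X n w)"
  let ?S = "\<lambda>b. if b then {..<beta_min P} else {beta_init P..}"
  let ?D = "\<lambda>b. coin n -` ?S b \<inter> space M"
  have v: "0 < beta_min P" "beta_min P \<le> beta_init P" "beta_init P < 1"
    using params by (auto simp: valid_params_def)
  have good: "coin_good n = {w \<in> space M. w \<in> ?D (?g w)}"
    by (auto simp: coin_good_def)
  have cM: "coin n \<in> borel_measurable M"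
    by (rule measurable_from_subalg[OF hist_sub coin_hist])
  have "(\<lambda>w. cur (X n w)) \<in> measurable (mid n) (count_space UNIV)"
    by (rule measurable_from_subalg[OF hist_mid measurable_compose[OF X_hist astate_measurable(1)]])
  moreover have "(\<lambda>w. cur (Y n w)) \<in> measurable (mid n) (count_space UNIV)"
    by (rule measurable_compose[OF Y_mid astate_measurable(1)])
  \<comment> \<open>Equality of two natural-number-valued functions is written as a countable union
    over their common value.\<close>
  ultimately have "{w \<in> space (mid n). \<exists>k. cur (Y n w) = k \<and> cur (X n w) = k} \<in> sets (mid n)"
    by measurable
  then have "{w \<in> space (mid n). ?g w} \<in> sets (mid n)"
    by (simp add: eq_commute)
  moreover from sets.compl_sets[OF this] have "{w \<in> space (mid n). \<not> ?g w} \<in> sets (mid n)"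
    by (rule back_subst[of "\<lambda>A. A \<in> sets (mid n)"]) auto
  ultimately have "{w \<in> space (mid n). ?g w = b} \<in> sets (mid n)" for b
    by (cases b) simp_all
  then have g: "{w \<in> space M. ?g w = b} \<in> sets (mid n)" for b
    by (simp add: subalgebra_space)
  have S: "?S b \<in> sets borel" for b by simp
  have prob: "prob (?D b) = measure lborel ({0..1} \<inter> ?S b)" for b
  proof -
    have "prob (?D b) = measure (uniform_measure lborel {0..1}) (?S b)"
      unfolding coin_distr[of n, symmetric] by (rule measure_distr[OF cM S, symmetric])
    also have "\<dots> = measure lborel ({0..1} \<inter> ?S b)"
      using S by (subst measure_uniform_measure) auto
    finally show ?thesis .
  qed
  have "{0..1} \<inter> {..<beta_min P} = {0..<beta_min P}" "{0..1} \<inter> {beta_init P..} = {beta_init P..1}"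
    using v by auto
  then have prob': "min (beta_min P) (1 - beta_init P) \<le> prob (?D b)" for b
    using v by (simp add: prob)
  show "min (beta_min P) (1 - beta_init P) * prob E \<le> prob (E \<inter> coin_good n)"
    unfolding good
    by (rule indep_set_partition[where D = ?D and g = ?g, OF subalgebra_sets(2) finite UNIV_I g
          coin_fresh in_vimage_algebra[OF S] prob' assms])
  have D: "{w \<in> space M. ?g w = b} \<inter> ?D b \<in> sets (hist (Suc n))" for b
  proof (rule sets.Int)
    show "{w \<in> space M. ?g w = b} \<in> sets (hist (Suc n))"
      by (rule subsetD[OF subalgebra_sets(4) g])
    show "?D b \<in> sets (hist (Suc n))"
      using measurable_sets[OF coin_hist[of n] S[of b]] by (simp only: subalgebra_space)
  qed
  have "coin_good n = {w \<in> space M. ?g w = True} \<inter> ?D True \<union> {w \<in> space M. ?g w = False} \<inter> ?D False"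
    unfolding good by auto
  with sets.Un[OF D[of True] D[of False]] show "coin_good n \<in> sets (hist (Suc n))"
    by (simp only:)
qed

text \<open>The draw is independent of \<open>hist n\<close> and the coin of \<open>mid n\<close>.
  The good-draw event belongs to \<open>mid n\<close>, so the two lower bounds multiply.\<close>

lemma AE_good_block:
  assumes h: "0 < h" and a: "a \<in> cbox (lower P) (upper P)"
  shows "AE w in M. \<exists>n. \<forall>k<L. w \<in> draw_good a h (n + k) \<inter> coin_good (n + k)"
proof -
  obtain \<epsilon> where e: "0 < \<epsilon>"
    "\<And>n E. E \<in> sets (hist n) \<Longrightarrow> \<epsilon> * prob E \<le> prob (E \<inter> draw_good a h n)"
    "\<And>n. draw_good a h n \<in> sets (mid n)"
    using draw_good_prob[OF h a] by blast
  define \<beta> where "\<beta> = min (beta_min P) (1 - beta_init P)"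
  have b: "0 < \<beta>" using params by (auto simp: \<beta>_def valid_params_def)
  show ?thesis
  proof (rule AE_exists_good_block[where H = hist and \<delta> = "\<beta> * \<epsilon>"])
    show "sets (hist n) \<subseteq> sets (hist (Suc n))" for n
      by (rule order_trans[OF subalgebra_sets(3,4)])
    show "space M \<in> sets (hist 0)"
      using sets.top[of "hist 0"] by (simp add: subalgebra_space)
    show "draw_good a h n \<inter> coin_good n \<in> sets (hist (Suc n))" for n
      using subsetD[OF subalgebra_sets(4) e(3)] coin_good_prob(2)[OF sets.empty_sets]
      by (rule sets.Int)
    show "\<beta> * \<epsilon> * prob E \<le> prob (E \<inter> (draw_good a h n \<inter> coin_good n))"
      if E: "E \<in> sets (hist n)" for n E
    proof -
      have "E \<inter> draw_good a h n \<in> sets (mid n)"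
        using subsetD[OF subalgebra_sets(3) E] e(3) by (rule sets.Int)
      from coin_good_prob(1)[OF this]
      have "\<beta> * prob (E \<inter> draw_good a h n) \<le> prob (E \<inter> (draw_good a h n \<inter> coin_good n))"
        by (simp add: \<beta>_def Int_assoc)
      moreover have "\<beta> * (\<epsilon> * prob E) \<le> \<beta> * prob (E \<inter> draw_good a h n)"
        using e(2)[OF E] b by (intro mult_left_mono) auto
      ultimately show ?thesis by (simp add: mult.assoc)
    qed
  qed (use subalgebra_sets(1) e(1) b in auto)
qed

section \<open>Pathwise consequences of good iterations\<close>

context
  fixes w
  assumes w: "w \<in> space M"
    and cube: "\<And>n k. k < 1000 * CARD('d) \<Longrightarrow> fst (draw n w k) \<in> cbox 0 1"
begin

lemma inv_X: "\<exists>lab. inv_state P (X n w) lab"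
proof (induction n)
  case 0
  then show ?case using doe_start_inv(1)[OF params start[OF w]] by blast
next
  case (Suc n)
  then obtain lab where "inv_state P (X n w) lab" ..
  from iteration_inv[OF params this step[OF w] cube] show ?case
    unfolding zoom[OF w] by blast
qed

lemma evaluated_subset: "evaluated pts n w \<subseteq> cbox (lower P) (upper P)"
  unfolding evaluated_def
  using inv_X iteration_points[OF params _ step[OF w] cube] by blast

lemma good_root_iteration:
  assumes h: "0 < h" and a: "a \<in> cbox (lower P) (upper P)"
    and inv: "inv_state P (X n w) lab" and r: "state_rank P (X n w) lab = 0"
    and good: "w \<in> draw_good a h n"
  shows "\<exists>z\<in>set (pts n w). dist z a \<le> real CARD('d) * h"
proof -
  have p: "pending (X n w) = []" and c: "cur (X n w) = 0"
    using r by (auto simp: state_rank_def split: if_splits)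
  have st: "srs_step P f (pool n w) (\<lambda>j. noise n j w) (draw n w) (xc n w) (pts n w) (X n w) (Y n w)"
    using step[OF w, of n] p by (simp add: iteration_def)
  note pt = srs_step_points[OF inv p st, unfolded c]
  have t: "good_tree P (tree (X n w)) lab" "0 < length (tree (X n w))"
    "sigma_crit P \<le> nsigma (tree (X n w) ! 0)"
    using inv p c by (auto simp: inv_state_def)
  \<comment> \<open>A parent has a smaller position than its child, so position 0 has none and must
    be the root.\<close>
  have "nparent (tree (X n w) ! 0) = None"
    using good_treeD(5)[OF t(1,2)] by (cases "nparent (tree (X n w) ! 0)") auto
  from good_treeD(4)[OF t(1,2) this]
  have geo: "nlo (tree (X n w) ! 0) = lower P" "nhi (tree (X n w) ! 0) = upper P" by auto
  have s: "nsigma (tree (X n w) ! 0) \<le> sigma_init P"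
    using good_treeD(1)[OF t(1,2)] by (simp add: good_node_def)
  have dg: "draw n w \<in> draw_target P a h (grid_index P a h (xc n w) (nsigma (tree (X n w) ! 0)))"
    using good by (simp add: draw_good_def)
  have "npar P \<ge> 1" using params by (simp add: valid_params_def)
  then have "hd (pts n w) \<in> set (pts n w)" using pt(2) by (intro hd_in_set) auto
  moreover from this pt(3) obtain k where "k < 1000 * CARD('d)"
    "hd (pts n w) = candidate (tree (X n w) ! 0) (xc n w) (draw n w) k"
    by blast
  ultimately show ?thesis
    using root_candidate_near[OF params h geo t(3) s pt(1) a dg] by metis
qed

text \<open>Each good iteration lowers a nonzero rank, so rank 0 is reached within
  \<open>state_rank_max P\<close> iterations; the \<open>Suc\<close> provides the good iteration
  that is then carried out at the root.\<close>

lemma good_block_hits: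
  assumes h: "0 < h" and a: "a \<in> cbox (lower P) (upper P)"
    and good: "\<forall>k<Suc (state_rank_max P). w \<in> draw_good a h (n + k) \<inter> coin_good (n + k)"
  shows "\<exists>m. \<exists>z\<in>set (pts m w). dist z a \<le> real CARD('d) * h"
proof -
  have hit: "\<exists>m. \<exists>z\<in>set (pts m w). dist z a \<le> real CARD('d) * h"
    if "inv_state P (X i w) lab" "state_rank P (X i w) lab = r"
      "\<forall>k<Suc r. w \<in> draw_good a h (i + k) \<inter> coin_good (i + k)" for r i lab
    using that
  proof (induction r arbitrary: i lab rule: less_induct)
    case (less r)
    have now: "w \<in> draw_good a h i" "w \<in> coin_good i"
      using less.prems(3)[rule_format, of 0] by auto
    show ?case
    proof (cases "r = 0")
      case True
      then have "state_rank P (X i w) lab = 0" using less.prems(2) by simp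
      from good_root_iteration[OF h a less.prems(1) this now(1)] show ?thesis ..
    next
      case False
      from iteration_inv[OF params less.prems(1) step[OF w] cube, of "coin i w"] False now(2) less.prems(2)
      obtain lab' where l: "inv_state P (X (Suc i) w) lab'" "state_rank P (X (Suc i) w) lab' < r"
        unfolding zoom[OF w] coin_good_def by auto
      have "w \<in> draw_good a h (Suc i + k) \<inter> coin_good (Suc i + k)"
        if "k < Suc (state_rank P (X (Suc i) w) lab')" for k
        using less.prems(3)[rule_format, of "Suc k"] that l(2) by simp
      with less.IH[OF l(2,1) refl] show ?thesis by blast
    qed
  qed
  obtain lab where lab: "inv_state P (X n w) lab" using inv_X by blast
  show ?thesis
    using hit[OF lab refl] good state_rank_le[OF params lab] by auto
qed

end

lemma AE_hits_every_ball:
  assumes a: "a \<in> cbox (lower P) (upper P)"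
  shows "AE w in M. \<forall>\<eta>>0. \<exists>m. \<exists>z\<in>set (pts m w). dist z a < \<eta>"
proof -
  \<comment> \<open>Chosen so that d times \<open>?h j\<close> is 1/(j+1); with countably many radii
    a single null set serves all \<open>\<eta>\<close>.\<close>
  let ?h = "\<lambda>j. 1 / (real CARD('d) * real (Suc j))"
  have "AE w in M. \<exists>m. \<exists>z\<in>set (pts m w). dist z a \<le> real CARD('d) * ?h j" for j
  proof -
    have h: "0 < ?h j" by simp
    show ?thesis
      using AE_space AE_draw_cube AE_good_block[OF h a, of "Suc (state_rank_max P)"]
    proof eventually_elim
      case (elim w)
      then show ?case using good_block_hits[OF _ _ h a] by metis
    qed
  qed
  then have "AE w in M. \<forall>j. \<exists>m. \<exists>z\<in>set (pts m w). dist z a \<le> real CARD('d) * ?h j"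
    by (simp only: AE_all_countable) blast
  then show ?thesis
  proof eventually_elim
    case (elim w)
    show ?case
    proof (intro allI impI)
      fix \<eta> :: real assume "0 < \<eta>"
      then obtain j where "inverse (real (Suc j)) < \<eta>" using reals_Archimedean by blast
      moreover have "real CARD('d) * ?h j = inverse (real (Suc j))"
        by (simp add: divide_simps del: of_nat_Suc)
      ultimately show "\<exists>m. \<exists>z\<in>set (pts m w). dist z a < \<eta>"
        using elim by (metis order_le_less_trans)
    qed
  qed
qed

end

theorem theorem1:
  fixes M :: "'w measure" and N :: "'n measure"
    and P :: "('d :: finite) params"
    and f :: "real ^ 'd \<Rightarrow> 'n \<Rightarrow> real"
    and F :: "real ^ 'd \<Rightarrow> real"
    and xopt :: "real ^ 'd"
    and x :: "nat \<Rightarrow> 'w \<Rightarrow> real ^ 'd"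
  assumes run: "prosrs_run M N P f hist mid noise draw coin pool0 pool xc pts X Y"
    and integrable: "\<And>z. z \<in> cbox (lower P) (upper P) \<Longrightarrow> integrable N (f z)"
    and objective: "\<And>z. z \<in> cbox (lower P) (upper P) \<Longrightarrow> F z = (\<integral>\<omega>. f z \<omega> \<partial>N)"
    and continuous: "continuous_on (cbox (lower P) (upper P)) F"
    and xopt_in: "xopt \<in> cbox (lower P) (upper P)"
    and xopt_min: "ereal (F xopt) = (INF z \<in> cbox (lower P) (upper P). ereal (F z))"
    and xopt_unique: "\<And>\<eta>. \<eta> > 0 \<Longrightarrow>
          (INF z \<in> {z \<in> cbox (lower P) (upper P). norm (z - xopt) \<ge> \<eta>}. ereal (F z)) > ereal (F xopt)"
    and best_evaluated: "\<And>n w. n \<ge> 1 \<Longrightarrow> w \<in> space M \<Longrightarrow> x n w \<in> evaluated pts n w"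
    and best_minimal: "\<And>n w z. n \<ge> 1 \<Longrightarrow> w \<in> space M \<Longrightarrow> z \<in> evaluated pts n w \<Longrightarrow>
          F (x n w) \<le> F z"
  shows "AE w in M. (\<lambda>n. x n w) \<longlonglongrightarrow> xopt"
proof -
  interpret prosrs_run M N P f hist mid noise draw coin pool0 pool xc pts X Y by (rule run)
  let ?D = "cbox (lower P) (upper P)"
  show ?thesis
    using AE_space AE_draw_cube AE_hits_every_ball[OF xopt_in]
  proof eventually_elim
    case (elim w)
    have sub: "evaluated pts n w \<subseteq> ?D" for n
      by (rule evaluated_subset) (use elim in auto)
    show ?case
    proof (rule LIMSEQ_I)
      fix \<eta> :: real assume \<eta>: "0 < \<eta>"
      \<comment> \<open>A level strictly between the minimum and the values at distance at least
        \<open>\<eta>\<close>; it is real even if no such points exist and the infimum is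
        infinite.\<close>
      obtain c where c: "ereal (F xopt) < ereal c"
        "ereal c < (INF z \<in> {z \<in> ?D. norm (z - xopt) \<ge> \<eta>}. ereal (F z))"
        using ereal_dense2[OF xopt_unique[OF \<eta>]] by blast
      have far: "c < F z" if "z \<in> ?D" "norm (z - xopt) \<ge> \<eta>" for z
      proof -
        have "(INF z \<in> {z \<in> ?D. norm (z - xopt) \<ge> \<eta>}. ereal (F z)) \<le> ereal (F z)"
          using that by (intro INF_lower) auto
        from less_le_trans[OF c(2) this] show ?thesis by simp
      qed
      obtain \<delta> where \<delta>: "0 < \<delta>" "\<And>z. z \<in> ?D \<Longrightarrow> dist z xopt < \<delta> \<Longrightarrow> dist (F z) (F xopt) < c - F xopt"
        using continuous xopt_in c(1) unfolding continuous_on_iff by (metis diff_gt_0_iff_gt ereal_less_eq(3) less_ereal.simps(1))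
      obtain m z where z: "z \<in> set (pts m w)" "dist z xopt < \<delta>"
        using elim(3) \<delta>(1) by blast
      have zD: "z \<in> ?D" using sub[of "Suc m"] z(1) by (auto simp: evaluated_def)
      have Fz: "F z < c" using \<delta>(2)[OF zD z(2)] by (simp add: dist_real_def abs_less_iff)
      show "\<exists>n0. \<forall>n\<ge>n0. norm (x n w - xopt) < \<eta>"
      proof (intro exI allI impI)
        \<comment> \<open>The points of iteration m belong to \<open>evaluated pts n w\<close> from
          n = m + 1 on, as its union runs over indices below n.\<close>
        fix n assume n: "Suc m \<le> n"
        then have n1: "1 \<le> n" by simp
        have "z \<in> evaluated pts n w" using n z(1) by (auto simp: evaluated_def)
        with best_minimal[OF n1 elim(1)] Fz have "F (x n w) < c" by fastforce
        moreover have "x n w \<in> ?D" using best_evaluated[OF n1 elim(1)] sub by blast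
        ultimately show "norm (x n w - xopt) < \<eta>" using far by fastforce
      qed
    qed
  qed
qed

end
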